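(* Let $\sigma\in L^\infty(\mathbb{T})$ with $\sigma_{\min}:=\inf_{x\in\mathbb{T}}\sigma(x)>0$ and $\sigma_{\max}:=\sup_{x\in\mathbb{T}}\sigma(x)$, and let $u_1,u_2,u_3\in C([0,\infty);L^2(\mathbb{T}))$ be mild real-valued solutions of $$\partial_tu_1(x,t)+\sqrt{\tfrac23}\,\partial_xu_2(x,t)=0,$$ $$\partial_tu_2(x,t)+\sqrt{\tfrac23}\,\partial_xu_1(x,t)+\tfrac1{\sqrt3}\,\partial_xu_3(x,t)=-\sigma(x)u_2(x,t),$$ $$\partial_tu_3(x,t)+\tfrac1{\sqrt3}\,\partial_xu_2(x,t)=-\sigma(x)u_3(x,t)$$ on $\mathbb{T}\times(0,\infty)$ with initial data $u_{1,0},u_{2,0},u_{3,0}\in L^2(\mathbb{T})$. Let $u_\infty=\frac{1}{2\pi}\int_0^{2\pi}u_{1,0}(x)\,dx$. Let $\theta>0$ and $\alpha>0$ be such that $$\sqrt{\tfrac23}\,\theta+\alpha<2\sigma_{\min},\qquad\alpha\le\sqrt{\tfrac23}\,\theta$$ and $$\frac{\theta^2\sigma_{\max}^2}{8\sigma_{\min}-4\sqrt{\frac23}\,\theta-4\alpha}+\frac{\theta^2}{12(2\sigma_{\min}-\alpha)}\le\sqrt{\tfrac23}\,\theta-\alpha.$$ Then for all $t\ge0$ $$\mathfrak{E}_\theta(u_1(t)-u_\infty,u_2(t),u_3(t))\le\mathfrak{E}_\theta(u_{1,0}-u_\infty,u_{2,0},u_{3,0})\,e^{-\alpha t}.$$ In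 particular, for $$\alpha:=\min\Big(\frac{\sigma_{\min}}2,\frac{3\sigma_{\min}}{9\sigma_{\max}^2+1}\Big)$$ the functional $\mathfrak{E}_{\sqrt6\,\alpha}$ decays exponentially to zero with rate $\alpha$, i.e. $\mathfrak{E}_{\sqrt6\alpha}(u_1(t)-u_\infty,u_2(t),u_3(t))\le\mathfrak{E}_{\sqrt6\alpha}(u_{1,0}-u_\infty,u_{2,0},u_{3,0})\,e^{-\alpha t}$ for all $t\ge0$, and $\mathfrak{E}_{\sqrt6\alpha}(u_1(t)-u_\infty,u_2(t),u_3(t))\to0$ as $t\to\infty$.
   Context: $\mathbb{T}$ is the one-dimensional torus, i.e. $[0,2\pi]$ with periodic boundary conditions. $\|f\|^2=\frac1{2\pi}\int_0^{2\pi}|f(x)|^2dx$. The anti-derivative of $f$ is $\partial_x^{-1}f(x):=\int_0^xf(y)\,dy-\frac1{2\pi}\int_0^{2\pi}\Big(\int_0^zf(y)\,dy\Big)dz$. For real-valued $f,g,h\in L^2(\mathbb{T})$, $$\mathfrak{E}_\theta(f,g,h):=\|f\|^2+\|g\|^2+\|h\|^2-\frac{\theta}{2\pi}\int_0^{2\pi}\partial_x^{-1}f(x)\,g(x)\,dx.$$ Mild solution is meant in the sense of semigroup theory, for the $C_0$-semigroup on $L^2(\mathbb{T})^3$ generated by $A(u_1,u_2,u_3)=\big(-\sqrt{\frac23}\partial_xu_2,\,-\sqrt{\frac23}\partial_xu_1-\frac1{\sqrt3}\partial_xu_3-\sigma u_2,\,-\frac1{\sqrt3}\partial_xu_2-\sigma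 u_3\big)$ (with its natural maximal domain in $L^2(\mathbb{T})^3$). Infima and suprema of $\sigma$ over $x\in\mathbb{T}$ are essential infima and suprema. *)

theory Defs
  imports "HOL-Probability.Essential_Supremum"
begin

abbreviation torus :: "real measure" where
  "torus \<equiv> lebesgue_on {0..2 * pi}"

definition square_integrable :: "(real \<Rightarrow> real) \<Rightarrow> bool" where
  "square_integrable f \<longleftrightarrow> f \<in> borel_measurable torus \<and> integrable torus (\<lambda>x. (f x)\<^sup>2)"

lemma square_integrable_0: "square_integrable (\<lambda>_. 0)"
  by (simp add: square_integrable_def)

lemma square_integrable_const: "square_integrable (\<lambda>_. c)"
  by (auto simp: square_integrable_def finite_measure.integrable_const finite_measure_lebesgue_on)

lemma square_integrable_mult:
  assumes "square_integrable f" "square_integrable g"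
  shows "integrable torus (\<lambda>x. f x * g x)"
proof (rule Bochner_Integration.integrable_bound)
  show "integrable torus (\<lambda>x. (f x)\<^sup>2 + (g x)\<^sup>2)"
    using assms by (simp add: square_integrable_def)
  show "(\<lambda>x. f x * g x) \<in> borel_measurable torus"
    using assms by (auto simp: square_integrable_def intro: borel_measurable_times)
  have "\<bar>f x * g x\<bar> \<le> (f x)\<^sup>2 + (g x)\<^sup>2" for x
  proof -
    have "2 * (\<bar>f x\<bar> * \<bar>g x\<bar>) \<le> (f x)\<^sup>2 + (g x)\<^sup>2"
      using sum_squares_bound[of "\<bar>f x\<bar>" "\<bar>g x\<bar>"] by (simp add: mult.assoc)
    moreover have "0 \<le> \<bar>f x\<bar> * \<bar>g x\<bar>" by simp
    ultimately show ?thesis unfolding abs_mult by linarith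
  qed
  then show "AE x in torus. norm (f x * g x) \<le> norm ((f x)\<^sup>2 + (g x)\<^sup>2)" by simp
qed

lemma square_integrable_add:
  assumes "square_integrable f" "square_integrable g"
  shows "square_integrable (\<lambda>x. f x + g x)"
proof -
  have "integrable torus (\<lambda>x. (f x)\<^sup>2 + (g x)\<^sup>2 + 2 * (f x * g x))"
    using assms square_integrable_mult[OF assms] by (auto simp: square_integrable_def)
  then show ?thesis
    using assms
    by (auto simp: square_integrable_def power2_sum mult.assoc intro: borel_measurable_add)
qed

lemma square_integrable_scale:
  "square_integrable f \<Longrightarrow> square_integrable (\<lambda>x. c * f x)"
  by (auto simp: square_integrable_def power_mult_distrib)

definition l2_rel :: "(real \<Rightarrow> real) \<Rightarrow> (real \<Rightarrow> real) \<Rightarrow> bool" where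
  "l2_rel f g \<longleftrightarrow> square_integrable f \<and> square_integrable g \<and> (AE x in torus. f x = g x)"

quotient_type l2 = "real \<Rightarrow> real" / partial: l2_rel
proof (rule part_equivpI)
  show "\<exists>f. l2_rel f f" using square_integrable_0 by (auto simp: l2_rel_def)
  show "symp l2_rel" by (auto intro!: sympI simp: l2_rel_def elim: AE_mp)
  show "transp l2_rel"
    by (rule transpI) (auto simp: l2_rel_def elim: eventually_elim2)
qed

instantiation l2 :: real_vector
begin

lift_definition zero_l2 :: l2 is "\<lambda>_. 0"
  by (simp add: l2_rel_def square_integrable_0)

lift_definition plus_l2 :: "l2 \<Rightarrow> l2 \<Rightarrow> l2" is "\<lambda>f g x. f x + g x"
  by (auto simp: l2_rel_def square_integrable_add elim: eventually_elim2)

lift_definition scaleR_l2 :: "real \<Rightarrow> l2 \<Rightarrow> l2" is "\<lambda>c f x. c * f x"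
  by (auto simp: l2_rel_def square_integrable_scale)

lift_definition uminus_l2 :: "l2 \<Rightarrow> l2" is "\<lambda>f x. - f x"
  using square_integrable_scale[of _ "-1"] by (auto simp: l2_rel_def)

lift_definition minus_l2 :: "l2 \<Rightarrow> l2 \<Rightarrow> l2" is "\<lambda>f g x. f x - g x"
  using square_integrable_add[OF _ square_integrable_scale[of _ "-1"]]
  by (auto simp: l2_rel_def elim: eventually_elim2)

instance
proof
  fix f g h :: l2 and c d :: real
  show "f + g + h = f + (g + h)"
    by transfer (auto simp: l2_rel_def square_integrable_add add.assoc)
  show "f + g = g + f"
    by transfer (auto simp: l2_rel_def square_integrable_add add.commute)
  show "0 + f = f" by transfer (auto simp: l2_rel_def)
  show "- f + f = 0"
    by transfer (auto simp: l2_rel_def square_integrable_0)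
  show "f - g = f + - g"
    using square_integrable_add[OF _ square_integrable_scale[of _ "-1"]]
    by transfer (auto simp: l2_rel_def)
  show "c *\<^sub>R (f + g) = c *\<^sub>R f + c *\<^sub>R g"
    by transfer (auto simp: l2_rel_def distrib_left square_integrable_add square_integrable_scale)
  show "(c + d) *\<^sub>R f = c *\<^sub>R f + d *\<^sub>R f"
    by transfer (auto simp: l2_rel_def distrib_right square_integrable_add square_integrable_scale)
  show "c *\<^sub>R d *\<^sub>R f = (c * d) *\<^sub>R f"
    by transfer (simp add: l2_rel_def mult.assoc square_integrable_scale)
  show "1 *\<^sub>R f = f" by transfer (auto simp: l2_rel_def)
qed

end

instantiation l2 :: real_inner
begin

lift_definition inner_l2 :: "l2 \<Rightarrow> l2 \<Rightarrow> real" is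
  "\<lambda>f g. (LINT x|torus. f x * g x) / (2 * pi)"
  by (auto simp: l2_rel_def square_integrable_def intro!: integral_cong_AE elim: eventually_elim2)

definition norm_l2 :: "l2 \<Rightarrow> real" where "norm_l2 f = sqrt (inner f f)"
definition sgn_l2 :: "l2 \<Rightarrow> l2" where "sgn_l2 f = f /\<^sub>R norm f"
definition dist_l2 :: "l2 \<Rightarrow> l2 \<Rightarrow> real" where "dist_l2 f g = norm (f - g)"
definition uniformity_l2 :: "(l2 \<times> l2) filter" where
  "uniformity_l2 = (INF e\<in>{0<..}. principal {(f, g). dist f g < e})"
definition open_l2 :: "l2 set \<Rightarrow> bool" where
  "open_l2 U \<longleftrightarrow> (\<forall>f\<in>U. \<forall>\<^sub>F (f', g) in uniformity. f' = f \<longrightarrow> g \<in> U)"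

instance
proof
  fix f g h :: l2 and c :: real and U :: "l2 set"
  show "sgn f = f /\<^sub>R norm f" by (rule sgn_l2_def)
  show "dist f g = norm (f - g)" by (rule dist_l2_def)
  show "(uniformity :: (l2 \<times> l2) filter) = (INF e\<in>{0<..}. principal {(f, g). dist f g < e})"
    by (rule uniformity_l2_def)
  show "open U \<longleftrightarrow> (\<forall>f\<in>U. \<forall>\<^sub>F (f', g) in uniformity. f' = f \<longrightarrow> g \<in> U)"
    by (rule open_l2_def)
  show "inner f g = inner g f" by transfer (simp add: mult.commute)
  show "inner (f + g) h = inner f h + inner g h"
    by transfer (simp add: l2_rel_def distrib_right square_integrable_mult add_divide_distrib)
  show "inner (c *\<^sub>R f) g = c * inner f g"
    by transfer (simp add: mult.assoc)
  show "0 \<le> inner f f" by transfer simp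
  show "inner f f = 0 \<longleftrightarrow> f = 0"
  proof transfer
    fix f assume f: "l2_rel f f"
    then have "integrable torus (\<lambda>x. f x * f x)" by (simp add: l2_rel_def square_integrable_mult)
    then have "(LINT x|torus. f x * f x) = 0 \<longleftrightarrow> (AE x in torus. f x * f x = 0)"
      by (intro integral_nonneg_eq_0_iff_AE) auto
    then show "(LINT x|torus. f x * f x) / (2 * pi) = 0 \<longleftrightarrow> l2_rel f (\<lambda>_. 0)"
      using f by (simp add: l2_rel_def square_integrable_0)
  qed
  show "norm f = sqrt (inner f f)" by (rule norm_l2_def)
qed

end

lift_definition const_l2 :: "real \<Rightarrow> l2" is "\<lambda>c _. c"
  by (simp add: l2_rel_def square_integrable_const)

(* Inner product and norm of l2 carry the normalising factor 1/(2 pi).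
   Integrals of a representative do not depend on its choice, so the following notions are stated
   for functions and applied to elements of l2 through rep_l2. *)

definition mean :: "(real \<Rightarrow> real) \<Rightarrow> real" where
  "mean f = (LINT x|torus. f x) / (2 * pi)"

definition antideriv :: "(real \<Rightarrow> real) \<Rightarrow> real \<Rightarrow> real" where
  "antideriv f x = (LINT y|lebesgue_on {0..x}. f y) - mean (\<lambda>z. LINT y|lebesgue_on {0..z}. f y)"

definition energy :: "real \<Rightarrow> l2 \<Rightarrow> l2 \<Rightarrow> l2 \<Rightarrow> real" where
  "energy \<theta> f g h = (norm f)\<^sup>2 + (norm g)\<^sup>2 + (norm h)\<^sup>2
     - \<theta> / (2 * pi) * (LINT x|torus. antideriv (rep_l2 f) x * rep_l2 g x)"

definition L_infinity :: "(real \<Rightarrow> real) \<Rightarrow> bool" where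
  "L_infinity \<sigma> \<longleftrightarrow> \<sigma> \<in> borel_measurable torus \<and> esssup torus (\<lambda>x. ereal \<bar>\<sigma> x\<bar>) < \<infinity>"

definition ess_sup :: "(real \<Rightarrow> real) \<Rightarrow> real" where
  "ess_sup \<sigma> = real_of_ereal (esssup torus (\<lambda>x. ereal (\<sigma> x)))"

(* Mirrors the library definition of esssup, which has no dual. *)

definition ess_inf :: "(real \<Rightarrow> real) \<Rightarrow> real" where
  "ess_inf \<sigma> = real_of_ereal (Liminf (ae_filter torus) (\<lambda>x. ereal (\<sigma> x)))"

definition C0_semigroup :: "(real \<Rightarrow> 'a::real_normed_vector \<Rightarrow>\<^sub>L 'a) \<Rightarrow> bool" where
  "C0_semigroup T \<longleftrightarrow>
     T 0 = id_blinfun \<and>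
     (\<forall>s\<ge>0. \<forall>t\<ge>0. T (s + t) = T s o\<^sub>L T t) \<and>
     (\<forall>x. ((\<lambda>t. T t x) \<longlongrightarrow> x) (at_right 0))"

text \<open>Unbounded operators are given by their graphs.\<close>

definition generator ::
    "(real \<Rightarrow> 'a::real_normed_vector \<Rightarrow>\<^sub>L 'a) \<Rightarrow> ('a \<times> 'a) set" where
  "generator T = {(x, y). ((\<lambda>h. (T h x - x) /\<^sub>R h) \<longlongrightarrow> y) (at_right 0)}"

text \<open>A generator determines its semigroup, so there is at most one \<open>T\<close> below.\<close>

definition mild_solution ::
    "('a::real_normed_vector \<times> 'a) set \<Rightarrow> 'a \<Rightarrow> (real \<Rightarrow> 'a) \<Rightarrow> bool" where
  "mild_solution A x u \<longleftrightarrow>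
     (\<exists>T. C0_semigroup T \<and> generator T = A \<and> (\<forall>t\<ge>0. u t = T t x))"

definition test_function :: "(real \<Rightarrow> real) \<Rightarrow> bool" where
  "test_function \<phi> \<longleftrightarrow>
     (\<forall>x. \<phi> (x + 2 * pi) = \<phi> x) \<and> (\<forall>k x. (deriv ^^ k) \<phi> differentiable (at x))"

definition distr :: "(real \<Rightarrow> real) \<Rightarrow> (real \<Rightarrow> real) \<Rightarrow> real" where
  "distr f \<phi> = (LINT x|torus. f x * \<phi> x)"

definition ddx :: "((real \<Rightarrow> real) \<Rightarrow> real) \<Rightarrow> (real \<Rightarrow> real) \<Rightarrow> real" where
  "ddx D \<phi> = - D (deriv \<phi>)"

text \<open>Maximal domain: \<open>u\<close> belongs to it iff the distribution \<open>A u\<close> is (represented by) an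
  element \<open>v\<close> of \<open>L\<^sup>2\<close>. In particular \<open>u\<^sub>1\<close> and \<open>u\<^sub>3\<close> need not be weakly differentiable separately.\<close>

definition wave_operator :: "(real \<Rightarrow> real) \<Rightarrow> ((l2 \<times> l2 \<times> l2) \<times> (l2 \<times> l2 \<times> l2)) set" where
  "wave_operator \<sigma> = {((u1, u2, u3), (v1, v2, v3)). \<forall>\<phi>. test_function \<phi> \<longrightarrow>
     distr (rep_l2 v1) \<phi> = - sqrt (2/3) * ddx (distr (rep_l2 u2)) \<phi> \<and>
     distr (rep_l2 v2) \<phi> = - sqrt (2/3) * ddx (distr (rep_l2 u1)) \<phi>
        - 1 / sqrt 3 * ddx (distr (rep_l2 u3)) \<phi> - distr (\<lambda>x. \<sigma> x * rep_l2 u2 x) \<phi> \<and>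
     distr (rep_l2 v3) \<phi> = - (1 / sqrt 3) * ddx (distr (rep_l2 u2)) \<phi>
        - distr (\<lambda>x. \<sigma> x * rep_l2 u3 x) \<phi>}"

end

theory Submission
  imports Defs
begin

text \<open>
  On the domain of the generator, the balance law for the energy follows from integration by parts:
  the skew symmetric coupling terms cancel, the damping controls \<open>u\<^sub>2\<close> and \<open>u\<^sub>3\<close>, and the mixed term
  of the functional creates the missing dissipation \<open>- \<theta> \<surd>(2/3) \<parallel>u\<^sub>1 - u\<^sub>\<infinity>\<parallel>\<^sup>2\<close>. The remaining terms are
  absorbed by Young's inequality and Wirtinger's inequality with the sharp constant 1.
  To avoid a density argument in the domain, the mild solution \<open>u\<close> is replaced by its averages
  \<open>w(t) = 1/h \<integral> u(s) ds\<close> over \<open>[t, t + h]\<close>, which are classical solutions with derivative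
  \<open>(u(t + h) - u(t))/h\<close>; the decay estimate passes to the limit \<open>h \<rightarrow> 0\<close>. The averages exist
  because \<open>L\<^sup>2\<close> is complete.
\<close>

section \<open>Functions with an integrable derivative\<close>

text \<open>The maximal domain yields weak derivatives only of u2 and of the combination sqrt(2/3)
  u1 + u3 / sqrt 3, so every integration by parts has to use this combination as a whole. Write J
  for the anti-derivative. It is skew and a contraction on functions of mean zero, in general not
  otherwise, and J f' = f - mean f. Hence the mean of u1 has to be conserved and subtracted, while
  that of u2, which need not vanish, enters with a favourable sign. The term \<alpha> <J f, u2>
  coming from the energy is combined with the damping term <J f, \<sigma> u2>: the factor \<sigma> -
  \<alpha> lies between 0 and \<sigma>max, so \<alpha> costs nothing in this cross term. What
  remains is a quadratic form in the three norms without a product of the norms of u2 and u3;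
  completing two squares gives exactly the third condition on \<theta> and \<alpha>. The domain is
  described by smooth periodic test functions, and the completeness of trigonometric polynomials is
  what turns such weak derivatives into genuine primitives.\<close>

text \<open>Absolute continuity in integral form: \<open>f\<close> is an almost everywhere
  derivative of \<open>F\<close> and matters only up to null sets, as suits representatives of
  elements of \<open>l2\<close>.\<close>

definition primitive_on :: "real \<Rightarrow> real \<Rightarrow> (real \<Rightarrow> real) \<Rightarrow> (real \<Rightarrow> real) \<Rightarrow> bool" where
  "primitive_on a b F f \<longleftrightarrow> integrable (lebesgue_on {a..b}) f \<and>
     (\<forall>x\<in>{a..b}. F x = F a + (LINT y|lebesgue_on {a..x}. f y))"

lemma primitive_onD:
  assumes "primitive_on a b F f"
  shows "integrable (lebesgue_on {a..b}) f"
    "x \<in> {a..b} \<Longrightarrow> F x = F a + (LINT y|lebesgue_on {a..x}. f y)"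
  using assms unfolding primitive_on_def by blast+

lemma primitive_on_diff:
  assumes "primitive_on a b F f" "c \<in> {a..b}" "d \<in> {a..b}" "c \<le> d"
  shows "(LINT y|lebesgue_on {c..d}. f y) = F d - F c"
proof -
  have "integrable (lebesgue_on {a..d}) f"
    by (rule integrable_subinterval[OF primitive_onD(1)[OF assms(1)]]) (use assms in auto)
  from integral_combine[OF this, of c] show ?thesis
    using primitive_onD(2)[OF assms(1), of c] primitive_onD(2)[OF assms(1), of d] assms by simp
qed

lemma primitive_on_subinterval:
  assumes "primitive_on a b F f" "{c..d} \<subseteq> {a..b}"
  shows "primitive_on c d F f"
  unfolding primitive_on_def
proof (intro conjI ballI)
  show "integrable (lebesgue_on {c..d}) f"
    by (rule integrable_subinterval[OF primitive_onD(1)[OF assms(1)] assms(2)])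
  fix x assume "x \<in> {c..d}"
  with assms(2) show "F x = F c + (LINT y|lebesgue_on {c..x}. f y)"
    by (subst primitive_on_diff[OF assms(1)]) auto
qed

lemma primitive_on_continuous:
  assumes "primitive_on a b F f"
  shows "continuous_on {a..b} F"
proof -
  have "continuous_on {a..b} (\<lambda>x. F a + (LINT y|lebesgue_on {a..x}. f y))"
    by (intro continuous_intros indefinite_integral_continuous_real primitive_onD(1)[OF assms])
  then show ?thesis
    by (subst continuous_on_cong[OF refl primitive_onD(2)[OF assms]])
qed

lemma primitive_on_integrable:
  "primitive_on a b F f \<Longrightarrow> integrable (lebesgue_on {a..b}) F"
  by (intro continuous_imp_integrable_real primitive_on_continuous)

lemma primitive_on_indefinite_integral:
  assumes "integrable (lebesgue_on {a..b}) f"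
  shows "primitive_on a b (\<lambda>x. c + (LINT y|lebesgue_on {a..x}. f y)) f"
proof -
  have "(LINT y|lebesgue_on {a..a}. f y) = 0"
    by (rule integral_eq_zero_null_sets) auto
  then show ?thesis using assms by (auto simp: primitive_on_def)
qed

lemma primitive_on_C1:
  assumes "\<And>x. x \<in> {a..b} \<Longrightarrow> (F has_real_derivative f x) (at x)" "continuous_on {a..b} f"
  shows "primitive_on a b F f"
  unfolding primitive_on_def
proof (intro conjI ballI)
  show "integrable (lebesgue_on {a..b}) f"
    by (intro continuous_imp_integrable_real assms)
  fix x assume x: "x \<in> {a..b}"
  have "integrable (lebesgue_on {a..x}) f"
    by (intro continuous_imp_integrable_real continuous_on_subset[OF assms(2)]) (use x in auto)
  then have "(LINT y|lebesgue_on {a..x}. f y) = integral {a..x} f"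
    by (intro lebesgue_integral_eq_integral) auto
  moreover have "(f has_integral F x - F a) {a..x}"
    using x assms(1)
    by (intro fundamental_theorem_of_calculus)
      (auto simp flip: has_real_derivative_iff_has_vector_derivative
        intro: has_field_derivative_at_within)
  ultimately show "F x = F a + (LINT y|lebesgue_on {a..x}. f y)"
    by (simp add: integral_unique)
qed

lemma primitive_on_shift:
  assumes "primitive_on a b F f"
  shows "primitive_on a b (\<lambda>x. F x - c) f"
proof -
  have "F x - c = F a - c + (LINT y|lebesgue_on {a..x}. f y)" if "x \<in> {a..b}" for x
    using primitive_onD(2)[OF assms that] by linarith
  then show ?thesis using primitive_onD(1)[OF assms] unfolding primitive_on_def by blast
qed

lemma integrable_mult_continuous:
  fixes f G :: "real \<Rightarrow> real"
  assumes f: "integrable (lebesgue_on {a..b}) f" and G: "continuous_on {a..b} G"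
  shows "integrable (lebesgue_on {a..b}) (\<lambda>x. f x * G x)"
proof -
  have "compact (G ` {a..b})" by (intro compact_continuous_image G) auto
  then obtain B where B: "\<And>x. x \<in> {a..b} \<Longrightarrow> norm (G x) \<le> B"
    by (meson bounded_iff compact_imp_bounded imageI)
  show ?thesis
  proof (rule Bochner_Integration.integrable_bound[of _ "\<lambda>x. B * \<bar>f x\<bar>"])
    show "integrable (lebesgue_on {a..b}) (\<lambda>x. B * \<bar>f x\<bar>)" using f by auto
    have "G \<in> borel_measurable (lebesgue_on {a..b})"
      using continuous_imp_integrable_real[OF G] by auto
    then show "(\<lambda>x. f x * G x) \<in> borel_measurable (lebesgue_on {a..b})"
      using f by auto
    show "AE x in lebesgue_on {a..b}. norm (f x * G x) \<le> norm (B * \<bar>f x\<bar>)"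
    proof (rule AE_I2)
      fix x assume "x \<in> space (lebesgue_on {a..b})"
      then have "\<bar>G x\<bar> \<le> B" using B by auto
      then have "\<bar>f x\<bar> * \<bar>G x\<bar> \<le> \<bar>f x\<bar> * \<bar>B\<bar>" by (intro mult_left_mono) auto
      then show "norm (f x * G x) \<le> norm (B * \<bar>f x\<bar>)" by (simp add: abs_mult mult.commute)
    qed
  qed
qed

text \<open>Fubini for f(y) g(x) on the triangle y \<le> x: integrating first in y produces F - F a,
  integrating first in x produces G b - G. No pointwise differentiability is involved.\<close>

proposition integral_by_parts_primitive:
  assumes F: "primitive_on a b F f" and G: "primitive_on a b G g" and ab: "a \<le> b"
  shows "(LINT x|lebesgue_on {a..b}. f x * G x + F x * g x) = F b * G b - F a * G a"
proof -
  define M where "M = lebesgue_on {a..b}"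
  interpret finite_measure M unfolding M_def by (intro finite_measure_lebesgue_on) auto
  interpret P: pair_sigma_finite M M ..
  have f[measurable]: "f \<in> borel_measurable M" and g[measurable]: "g \<in> borel_measurable M"
    and fi: "integrable M f" and gi: "integrable M g"
    using primitive_onD(1)[OF F] primitive_onD(1)[OF G] by (auto simp: M_def)
  have id[measurable]: "(\<lambda>x. x) \<in> borel_measurable M"
    unfolding M_def using id_borel_measurable_lebesgue_on by (simp add: id_def)
  define H where "H = (\<lambda>x y. if y \<le> x then f y * g x else 0)"
  have int: "integrable (M \<Otimes>\<^sub>M M) (\<lambda>(x, y). H x y)"
  proof (rule Bochner_Integration.integrable_bound)
    show "integrable (M \<Otimes>\<^sub>M M) (\<lambda>(x, y). g x * f y)"
      by (rule P.Fubini_integrable) (use fi gi in \<open>auto simp: abs_mult\<close>)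
    show "(\<lambda>(x, y). H x y) \<in> borel_measurable (M \<Otimes>\<^sub>M M)" unfolding H_def by measurable
    show "AE z in M \<Otimes>\<^sub>M M. norm (case z of (x, y) \<Rightarrow> H x y) \<le> norm (case z of (x, y) \<Rightarrow> g x * f y)"
      by (rule AE_I2) (auto simp: H_def mult.commute split: prod.splits)
  qed
  have 1: "(LINT y|M. H x y) = (F x - F a) * g x" if "x \<in> {a..b}" for x
  proof -
    have "(LINT y|M. H x y) = (LINT y|M. g x * (if y \<in> {a..x} then f y else 0))"
      by (intro Bochner_Integration.integral_cong) (auto simp: H_def M_def)
    also have "\<dots> = g x * (LINT y|lebesgue_on {a..x}. f y)"
      using that unfolding M_def integral_mult_right_zero by (subst integral_restrict) auto
    finally show ?thesis using primitive_onD(2)[OF F that] by simp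
  qed
  have 2: "(LINT x|M. H x y) = f y * (G b - G y)" if "y \<in> {a..b}" for y
  proof -
    have "(LINT x|M. H x y) = (LINT x|M. f y * (if x \<in> {y..b} then g x else 0))"
      by (intro Bochner_Integration.integral_cong) (auto simp: H_def M_def)
    also have "\<dots> = f y * (LINT x|lebesgue_on {y..b}. g x)"
      using that unfolding M_def integral_mult_right_zero by (subst integral_restrict) auto
    finally show ?thesis using primitive_on_diff[OF G that, of b] that by simp
  qed
  have "(LINT x|M. (F x - F a) * g x) = (LINT x|M. LINT y|M. H x y)"
    by (intro Bochner_Integration.integral_cong) (auto simp: 1[unfolded M_def] M_def)
  also have "\<dots> = (LINT y|M. LINT x|M. H x y)"
    by (rule P.Fubini_integral[OF int, symmetric])
  also have "\<dots> = (LINT y|M. f y * (G b - G y))"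
    by (intro Bochner_Integration.integral_cong) (auto simp: 2[unfolded M_def] M_def)
  finally have eq: "(LINT x|M. (F x - F a) * g x) = (LINT y|M. f y * (G b - G y))" .
  have i: "integrable M (\<lambda>x. f x * G x)" "integrable M (\<lambda>x. F x * g x)"
    using integrable_mult_continuous[OF primitive_onD(1)[OF F] primitive_on_continuous[OF G]]
      integrable_mult_continuous[OF primitive_onD(1)[OF G] primitive_on_continuous[OF F]]
    by (simp_all add: M_def mult.commute)
  have "(LINT x|M. f x) = F b - F a" "(LINT x|M. g x) = G b - G a"
    unfolding M_def using primitive_onD(2)[OF F, of b] primitive_onD(2)[OF G, of b] ab by auto
  moreover have "(LINT x|M. (F x - F a) * g x) = (LINT x|M. F x * g x) - F a * (LINT x|M. g x)"
    unfolding left_diff_distrib using i gi by simp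
  moreover have "(LINT x|M. f x * (G b - G x)) = (LINT x|M. f x) * G b - (LINT x|M. f x * G x)"
    unfolding right_diff_distrib using i fi by simp
  moreover have "(LINT x|M. f x * G x + F x * g x) = (LINT x|M. f x * G x) + (LINT x|M. F x * g x)"
    using i by simp
  ultimately have "(LINT x|M. f x * G x + F x * g x) = (F b - F a) * G b + F a * (G b - G a)"
    using eq by simp
  then show ?thesis unfolding M_def by (simp add: algebra_simps)
qed

lemma primitive_on_mult:
  assumes F: "primitive_on a b F f" and G: "primitive_on a b G g"
  shows "primitive_on a b (\<lambda>x. F x * G x) (\<lambda>x. f x * G x + F x * g x)"
  unfolding primitive_on_def
proof (intro conjI ballI)
  show "integrable (lebesgue_on {a..b}) (\<lambda>x. f x * G x + F x * g x)"
    using integrable_mult_continuous[OF primitive_onD(1)[OF F] primitive_on_continuous[OF G]]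
      integrable_mult_continuous[OF primitive_onD(1)[OF G] primitive_on_continuous[OF F]]
    by (simp add: mult.commute)
  fix x assume x: "x \<in> {a..b}"
  show "F x * G x = F a * G a + (LINT y|lebesgue_on {a..x}. f y * G y + F y * g y)"
    using x integral_by_parts_primitive[OF primitive_on_subinterval[OF F] primitive_on_subinterval[OF G], of a x]
    by simp
qed

section \<open>Trigonometric polynomials\<close>

text \<open>The phase \<open>d\<close> covers sines and \<open>n = 0\<close> covers constants. With
  one kind of wave, differentiation is a phase shift by pi/2 and a product of two waves is a sum of
  two waves.\<close>

inductive trig_poly :: "(real \<Rightarrow> real) \<Rightarrow> bool" where
  wave: "trig_poly (\<lambda>x. c * cos (of_int n * x + d))"
| add: "trig_poly f \<Longrightarrow> trig_poly g \<Longrightarrow> trig_poly (\<lambda>x. f x + g x)"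

lemma trig_poly_const: "trig_poly (\<lambda>_. c)"
  using trig_poly.wave[of c 0 0] by simp

lemma trig_poly_scale: "trig_poly f \<Longrightarrow> trig_poly (\<lambda>x. a * f x)"
proof (induction rule: trig_poly.induct)
  case (wave c n d)
  then show ?case using trig_poly.wave[of "a * c" n d] by (simp add: mult.assoc)
qed (auto simp: distrib_left intro: trig_poly.add)

lemma trig_poly_mult: "trig_poly f \<Longrightarrow> trig_poly g \<Longrightarrow> trig_poly (\<lambda>x. f x * g x)"
proof (induction rule: trig_poly.induct)
  case (wave c n d)
  from wave show ?case
  proof (induction rule: trig_poly.induct)
    case (wave c' n' d')
    have "trig_poly (\<lambda>x. c * c' / 2 * cos (of_int (n - n') * x + (d - d'))
                   + c * c' / 2 * cos (of_int (n + n') * x + (d + d')))"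
      by (intro trig_poly.intros)
    moreover have "c * cos (of_int n * x + d) * (c' * cos (of_int n' * x + d'))
       = c * c' / 2 * cos (of_int (n - n') * x + (d - d'))
                   + c * c' / 2 * cos (of_int (n + n') * x + (d + d'))" for x :: real
    proof -
      have *: "of_int n * x + d - (of_int n' * x + d') = of_int (n - n') * x + (d - d')"
        "of_int n * x + d + (of_int n' * x + d') = of_int (n + n') * x + (d + d')"
        by (simp_all add: algebra_simps)
      have "c * cos (of_int n * x + d) * (c' * cos (of_int n' * x + d'))
        = c * c' * (cos (of_int n * x + d) * cos (of_int n' * x + d'))" by simp
      also have "\<dots> = c * c' * ((cos (of_int (n - n') * x + (d - d'))
                                 + cos (of_int (n + n') * x + (d + d'))) / 2)"
        unfolding cos_times_cos * ..
      finally show ?thesis by (simp add: distrib_left add_divide_distrib)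
    qed
    ultimately show ?case by simp
  qed (auto simp: distrib_left intro: trig_poly.add)
qed (auto simp: distrib_right intro: trig_poly.add)

lemma trig_poly_cos: "trig_poly cos"
  using trig_poly.wave[of 1 1 0] by simp

lemma trig_poly_sin: "trig_poly sin"
  using trig_poly.wave[of 1 1 "- (pi/2)"] by (simp add: cos_diff)

lemma trig_poly_deriv:
  assumes "trig_poly f"
  shows "\<exists>f'. trig_poly f' \<and> (\<forall>x. (f has_real_derivative f' x) (at x))"
  using assms
proof (induction rule: trig_poly.induct)
  case (wave c n d)
  have "((\<lambda>x. c * cos (of_int n * x + d)) has_real_derivative
      (c * of_int n) * cos (of_int n * x + (d + pi / 2))) (at x)" for x
    by (auto intro!: derivative_eq_intros simp: cos_add sin_add algebra_simps)
  then show ?case using trig_poly.wave by blast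
next
  case (add f g)
  then obtain f' g' where "trig_poly f'" "\<And>x. (f has_real_derivative f' x) (at x)"
    "trig_poly g'" "\<And>x. (g has_real_derivative g' x) (at x)" by blast
  then show ?case
    by (intro exI[of _ "\<lambda>x. f' x + g' x"]) (auto intro!: derivative_eq_intros trig_poly.add)
qed

lemma trig_poly_periodic: "trig_poly f \<Longrightarrow> f (x + 2 * pi) = f x"
proof (induction rule: trig_poly.induct)
  case (wave c n d)
  have "cos (of_int n * (x + 2 * pi) + d) = cos (of_int n * x + d + 2 * pi * of_int n)"
    by (simp add: algebra_simps)
  also have "\<dots> = cos (of_int n * x + d)"
    using cos_int_2pin[of n] sin_int_2pin[of n] by (simp add: cos_add)
  finally show ?case by simp
qed auto

lemma trig_poly_test_function:
  assumes "trig_poly f"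
  shows "test_function f"
proof -
  have "trig_poly ((deriv ^^ k) f)" for k
  proof (induction k)
    case (Suc k)
    from trig_poly_deriv[OF Suc] obtain g where
      g: "trig_poly g" "\<And>x. ((deriv ^^ k) f has_real_derivative g x) (at x)" by blast
    then have "deriv ((deriv ^^ k) f) = g" by (intro ext DERIV_imp_deriv)
    with g show ?case by simp
  qed (use assms in simp)
  then have "(deriv ^^ k) f differentiable (at x)" for k x
    using trig_poly_deriv real_differentiable_def by blast
  then show ?thesis
    unfolding test_function_def using trig_poly_periodic[OF assms] by blast
qed

text \<open>Nonzero constants have no periodic primitive, so the constant part \<open>m\<close> has
  to be removed first. This allows test functions to be written as S' + m with S again a test
  function.\<close>

lemma trig_poly_antideriv:
  assumes "trig_poly f"
  shows "\<exists>S m. trig_poly S \<and> (\<forall>x. (S has_real_derivative f x - m) (at x))"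
  using assms
proof (induction rule: trig_poly.induct)
  case (wave c n d)
  show ?case
  proof (cases "n = 0")
    case True
    then show ?thesis
      by (intro exI[of _ "\<lambda>_. 0"] exI[of _ "c * cos d"]) (auto intro: trig_poly_const)
  next
    case False
    have "cos (of_int n * x + (d - pi / 2)) = sin (of_int n * x + d)" for x
      by (simp add: cos_add sin_add cos_diff sin_diff)
    then have "trig_poly (\<lambda>x. (c / of_int n) * sin (of_int n * x + d))"
      using trig_poly.wave[of "c / of_int n" n "d - pi / 2"] by simp
    moreover have "((\<lambda>x. (c / of_int n) * sin (of_int n * x + d)) has_real_derivative
        c * cos (of_int n * x + d) - 0) (at x)" for x
      using False by (auto intro!: derivative_eq_intros)
    ultimately show ?thesis by blast
  qed
next
  case (add f g)
  then obtain S m S' m' where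
    "trig_poly S" "\<And>x. (S has_real_derivative f x - m) (at x)"
    "trig_poly S'" "\<And>x. (S' has_real_derivative g x - m') (at x)" by blast
  then show ?case
    by (intro exI[of _ "\<lambda>x. S x + S' x"] exI[of _ "m + m'"])
      (auto intro!: derivative_eq_intros trig_poly.add)
qed

lemma trig_poly_continuous: "trig_poly f \<Longrightarrow> continuous_on A f"
  by (metis trig_poly_deriv DERIV_isCont continuous_at_imp_continuous_on)

text \<open>A real linear form on the complex plane restricts to a combination of cos and sin on the
  unit circle; sums and products stay within trigonometric polynomials.\<close>

lemma real_polynomial_function_cis:
  "real_polynomial_function p \<Longrightarrow> trig_poly (\<lambda>x. p (cis x))"
proof (induction rule: real_polynomial_function.induct)
  case (linear f)
  interpret bounded_linear f by fact
  have "f (cis x) = f 1 * cos x + f \<i> * sin x" for x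
  proof -
    have "cis x = cos x *\<^sub>R 1 + sin x *\<^sub>R \<i>" by (auto simp: complex_eq_iff)
    then show ?thesis by (simp add: add scaleR)
  qed
  then show ?case
    using trig_poly.add[OF trig_poly_scale[OF trig_poly_cos] trig_poly_scale[OF trig_poly_sin], of "f 1" "f \<i>"] by simp
qed (auto intro: trig_poly_const trig_poly.add trig_poly_mult)

text \<open>
  \<open>\<phi>\<close> factors through the quotient map \<open>cis\<close> onto the unit circle, where Stone-Weierstrass applies.
\<close>

lemma trig_poly_dense:
  assumes cont: "continuous_on {0..2 * pi} \<phi>" and per: "\<phi> 0 = \<phi> (2 * pi)" and e: "e > 0"
  shows "\<exists>T. trig_poly T \<and> (\<forall>x\<in>{0..2 * pi}. \<bar>\<phi> x - T x\<bar> < e)"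
proof -
  define K where "K = {0..2 * pi}"
  define h where "h = (\<lambda>z. \<phi> (Arg2pi z))"
  have h: "h (cis x) = \<phi> x" if "x \<in> K" for x
  proof (cases "x = 2 * pi")
    case True
    then show ?thesis using per by (simp add: h_def Arg2pi_of_real[of 1, simplified])
  next
    case False
    then have "Arg2pi (cis x) = x"
      using that by (intro Arg2pi_unique[of 1]) (auto simp: K_def cis_conv_exp)
    then show ?thesis by (simp add: h_def)
  qed
  have cis: "continuous_on K cis" and comp: "compact K"
    by (auto simp: K_def intro!: continuous_intros)
  \<comment> \<open>\<open>Arg2pi\<close> jumps at 1, so \<open>h\<close> is not visibly continuous
    as a composition. Compactness of \<open>K\<close> makes \<open>cis\<close> a quotient map onto
    its image, and only the preimage under \<open>cis\<close> has to be open.\<close>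
  have conth: "continuous_on (cis ` K) h"
  proof (subst continuous_on_open, intro allI impI)
    fix U assume "openin (top_of_set (h ` cis ` K)) U"
    moreover have "h ` cis ` K = \<phi> ` K" using h by (auto simp: image_iff) 
    ultimately have U: "openin (top_of_set (\<phi> ` K)) U" by simp
    have "openin (top_of_set K) (K \<inter> \<phi> -` U)"
      using cont U unfolding K_def[symmetric] continuous_on_open by blast
    moreover have "K \<inter> \<phi> -` U = K \<inter> cis -` (cis ` K \<inter> h -` U)"
      using h by force
    ultimately have "openin (top_of_set K) (K \<inter> cis -` (cis ` K \<inter> h -` U))" by simp
    then show "openin (top_of_set (cis ` K)) (cis ` K \<inter> h -` U)"
      by (subst (asm) Abstract_Topology_2.continuous_imp_quotient_map[OF cis refl comp]) auto
  qed
  obtain p where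
    p: "real_polynomial_function p" "\<And>z. z \<in> cis ` K \<Longrightarrow> \<bar>h z - p z\<bar> < e"
    by (rule Stone_Weierstrass_real_polynomial_function[OF compact_continuous_image[OF cis comp] conth e])
      (rule that)
  have "\<bar>\<phi> x - p (cis x)\<bar> < e" if "x \<in> K" for x
    using p(2)[of "cis x"] h[OF that] that by simp
  then show ?thesis
    unfolding K_def by (intro exI[of _ "\<lambda>x. p (cis x)"] conjI real_polynomial_function_cis[OF p(1)] ballI)
qed

section \<open>Completeness of trigonometric polynomials for integrable functions\<close>

text \<open>Uniform approximation suffices for a merely integrable \<open>f\<close>: the error is at
  most \<open>e\<close> times its L1 norm.\<close>

lemma orthogonal_continuous:
  assumes f: "integrable torus f" and orth: "\<And>T. trig_poly T \<Longrightarrow> (LINT x|torus. f x * T x) = 0"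
    and cont: "continuous_on {0..2 * pi} \<phi>" and per: "\<phi> 0 = \<phi> (2 * pi)"
  shows "(LINT x|torus. f x * \<phi> x) = 0"
proof -
  have "\<bar>LINT x|torus. f x * \<phi> x\<bar> \<le> e * (LINT x|torus. \<bar>f x\<bar>)" if "e > 0" for e
  proof -
    obtain T where T: "trig_poly T" "\<And>x. x \<in> {0..2*pi} \<Longrightarrow> \<bar>\<phi> x - T x\<bar> < e"
      using trig_poly_dense[OF cont per \<open>e > 0\<close>] by blast
    have i: "integrable torus (\<lambda>x. f x * \<phi> x)" "integrable torus (\<lambda>x. f x * T x)"
      by (intro integrable_mult_continuous f cont trig_poly_continuous T(1))+
    have "(LINT x|torus. f x * \<phi> x) = (LINT x|torus. f x * \<phi> x - f x * T x)"
      using i orth[OF T(1)] by simp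
    also have "\<bar>\<dots>\<bar> \<le> (LINT x|torus. \<bar>f x * \<phi> x - f x * T x\<bar>)"
      by (rule integral_abs_bound)
    also have "\<dots> \<le> (LINT x|torus. e * \<bar>f x\<bar>)"
    proof (rule integral_mono)
      fix x assume "x \<in> space torus"
      then have "\<bar>\<phi> x - T x\<bar> \<le> e" using T(2)[of x] by auto
      then have "\<bar>f x\<bar> * \<bar>\<phi> x - T x\<bar> \<le> \<bar>f x\<bar> * e" by (intro mult_left_mono) auto
      then show "\<bar>f x * \<phi> x - f x * T x\<bar> \<le> e * \<bar>f x\<bar>"
        by (simp only: right_diff_distrib[symmetric] abs_mult real_norm_def) (simp add: mult.commute)
    qed (use f i in auto)
    finally show ?thesis by simp
  qed
  note bound = this
  define I where "I = (LINT x|torus. \<bar>f x\<bar>)"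
  have I: "I \<ge> 0" by (simp add: I_def)
  have "\<bar>LINT x|torus. f x * \<phi> x\<bar> \<le> 0 + e" if "e > 0" for e
  proof -
    \<comment> \<open>Dividing by \<open>I + 1\<close> instead of \<open>I\<close> covers the case
      \<open>I = 0\<close>.\<close>
    have "\<bar>LINT x|torus. f x * \<phi> x\<bar> \<le> e / (I + 1) * I"
      unfolding I_def by (rule bound) (use that I in \<open>simp flip: I_def\<close>)
    also have "\<dots> \<le> e" using I that by (simp add: field_simps)
    finally show ?thesis by simp
  qed
  then show ?thesis using field_le_epsilon[of "\<bar>LINT x|torus. f x * \<phi> x\<bar>" 0] by simp
qed

lemma trig_poly_complete:
  assumes f: "integrable torus f" and orth: "\<And>T. trig_poly T \<Longrightarrow> (LINT x|torus. f x * T x) = 0"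
  shows "AE x in torus. f x = 0"
proof -
  \<comment> \<open>test with continuous functions converging to \<open>sgn f\<close>, cut off to be periodic\<close>
  define s where "s = (\<lambda>x. sgn (f x))"
  have "s \<in> borel_measurable torus" using f unfolding s_def by measurable
  then have "s measurable_on {0..2*pi}" by (simp add: measurable_on_iff_borel_measurable)
  then obtain N g where N: "negligible N" and g: "\<And>n. continuous_on UNIV (g n)"
    and lim: "\<And>x. x \<notin> N \<Longrightarrow> x \<in> {0..2*pi} \<Longrightarrow> (\<lambda>n. g n x) \<longlonglongrightarrow> s x"
    unfolding measurable_on_def by (metis (full_types))
  \<comment> \<open>Clamping to [-1, 1] makes the absolute value of \<open>f\<close> a dominating
    function. The second factor vanishes at both endpoints and is eventually 1 at each interior
    point, so only a null set is lost in the limit.\<close>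
  define \<phi> where "\<phi> = (\<lambda>n x. max (-1) (min 1 (g n x)) * min 1 (real n * (x * (2 * pi - x))))"
  have contphi: "continuous_on {0..2*pi} (\<phi> n)" for n
    unfolding \<phi>_def by (intro continuous_intros continuous_on_subset[OF g]) auto
  have "(LINT x|torus. f x * \<phi> n x) = 0" for n
    by (rule orthogonal_continuous[OF f orth contphi]) (auto simp: \<phi>_def)
  moreover have "(\<lambda>n. LINT x|torus. f x * \<phi> n x) \<longlonglongrightarrow> (LINT x|torus. \<bar>f x\<bar>)"
  proof (rule integral_dominated_convergence)
    show "integrable torus (\<lambda>x. \<bar>f x\<bar>)" using f by simp
    show "(\<lambda>x. f x * \<phi> n x) \<in> borel_measurable torus" for n
      using integrable_mult_continuous[OF f contphi] by auto
    show "(\<lambda>x. \<bar>f x\<bar>) \<in> borel_measurable torus" using f by simp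
    show "AE x in torus. norm (f x * \<phi> n x) \<le> \<bar>f x\<bar>" for n
    proof (rule AE_I2)
      fix x assume x: "x \<in> space torus"
      then have "real n * (x * (2 * pi - x)) \<ge> 0" by auto
      then have "\<bar>\<phi> n x\<bar> \<le> 1 * 1" unfolding \<phi>_def abs_mult by (intro mult_mono) auto
      then have "\<bar>f x\<bar> * \<bar>\<phi> n x\<bar> \<le> \<bar>f x\<bar> * 1" by (intro mult_left_mono) auto
      then show "norm (f x * \<phi> n x) \<le> \<bar>f x\<bar>" by (simp add: abs_mult)
    qed
    have "insert 0 (insert (2 * pi) N) \<in> null_sets lebesgue"
      using N by (simp add: negligible_iff_null_sets)
    then have "AE x in lebesgue. x \<notin> insert 0 (insert (2 * pi) N)" by (rule AE_not_in)
    then have "AE x in torus. x \<notin> insert 0 (insert (2 * pi) N)"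
      by (subst AE_restrict_space_iff) auto
    moreover have "AE x in torus. x \<in> {0..2*pi}" by (rule AE_I2) auto
    ultimately show "AE x in torus. (\<lambda>n. f x * \<phi> n x) \<longlonglongrightarrow> \<bar>f x\<bar>"
    proof eventually_elim
      case (elim x)
      then have x: "0 < x" "x < 2 * pi" "x \<notin> N" by auto
      define r where "r = x * (2 * pi - x)"
      have r: "r > 0" using x by (simp add: r_def)
      obtain k where k: "real k * r > 1" using reals_Archimedean3[OF r] by blast
      have "\<forall>\<^sub>F n in sequentially. min 1 (real n * r) = 1"
        using eventually_ge_at_top[of k]
      proof eventually_elim
        case (elim n)
        then have "real k * r \<le> real n * r" using r by (intro mult_right_mono) auto
        with k show ?case by simp
      qed
      then have "(\<lambda>n. min 1 (real n * r)) \<longlonglongrightarrow> 1" by (rule tendsto_eventually)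
      moreover have "(\<lambda>n. max (-1) (min 1 (g n x))) \<longlonglongrightarrow> max (-1) (min 1 (s x))"
        by (intro tendsto_intros lim) (use x in auto)
      ultimately have "(\<lambda>n. f x * \<phi> n x) \<longlonglongrightarrow> f x * (max (-1) (min 1 (s x)) * 1)"
        unfolding \<phi>_def r_def by (intro tendsto_mult tendsto_const)
      moreover have "f x * (max (-1) (min 1 (s x)) * 1) = \<bar>f x\<bar>"
        by (simp add: s_def sgn_if abs_if)
      ultimately show ?case by simp
    qed
  qed
  ultimately have "(LINT x|torus. \<bar>f x\<bar>) = 0" by (simp add: LIMSEQ_unique)
  then have "AE x in torus. \<bar>f x\<bar> = 0"
    using f by (subst (asm) integral_nonneg_eq_0_iff_AE) auto
  then show ?thesis by simp
qed

section \<open>Weak derivatives and Wirtinger's inequality\<close>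

lemma antideriv_primitive:
  assumes "integrable torus f"
  shows "primitive_on 0 (2 * pi) (antideriv f) f"
proof -
  have "antideriv f = (\<lambda>x. - mean (\<lambda>z. LINT y|lebesgue_on {0..z}. f y) + (LINT y|lebesgue_on {0..x}. f y))"
    by (simp add: antideriv_def fun_eq_iff)
  then show ?thesis by (simp only: primitive_on_indefinite_integral[OF assms])
qed

lemma measure_torus [simp]: "measure torus {0..2 * pi} = 2 * pi"
  by (simp add: measure_restrict_space)

lemma integral_torus_const [simp]: "(LINT x|torus. c) = 2 * pi * (c::real)"
  by simp

lemma integrable_torus_const [simp]: "integrable torus (\<lambda>_. c::real)"
  by (rule continuous_imp_integrable_real) auto

lemma integral_antideriv:
  assumes "integrable torus f"
  shows "(LINT x|torus. antideriv f x) = 0"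
proof -
  have i: "integrable torus (\<lambda>x. 0 + (LINT y|lebesgue_on {0..x}. f y))"
    by (rule primitive_on_integrable[OF primitive_on_indefinite_integral[OF assms]])
  have "(LINT x|torus. antideriv f x) = (LINT x|torus. (LINT y|lebesgue_on {0..x}. f y))
      - 2 * pi * mean (\<lambda>z. LINT y|lebesgue_on {0..z}. f y)"
    unfolding antideriv_def using i by (subst Bochner_Integration.integral_diff) auto
  then show ?thesis by (simp add: mean_def)
qed

lemma antideriv_endpoints:
  assumes "integrable torus f" "(LINT x|torus. f x) = 0"
  shows "antideriv f (2 * pi) = antideriv f 0"
  using primitive_on_diff[OF antideriv_primitive[OF assms(1)], of 0 "2 * pi"] assms(2) by simp

lemma test_function_0_eq_AE:
  assumes "integrable torus f" "\<And>\<phi>. test_function \<phi> \<Longrightarrow> distr f \<phi> = 0"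
  shows "AE x in torus. f x = 0"
  using assms trig_poly_complete trig_poly_test_function unfolding distr_def by metis

text \<open>The du Bois-Reymond lemma on the torus. The constant test function gives mean zero of
  \<open>f\<close>, hence a periodic anti-derivative. The difference \<open>Q\<close> is then
  orthogonal to every T = S' + m: the part S' by testing with S and integrating by parts, the part m
  because \<open>Q\<close> has mean zero.\<close>

proposition weak_derivative_antideriv:
  assumes F: "integrable torus F" and f: "integrable torus f"
    and weak: "\<And>\<phi>. test_function \<phi> \<Longrightarrow> distr f \<phi> = ddx (distr F) \<phi>"
  shows "(LINT x|torus. f x) = 0"
    and "AE x in torus. F x = antideriv f x + mean F"
proof -
  have "deriv (\<lambda>_. 1) = (\<lambda>_. 0 :: real)" by auto
  then show f0: "(LINT x|torus. f x) = 0"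
    using weak[OF trig_poly_test_function[OF trig_poly_const[of 1]]] by (simp add: distr_def ddx_def)
  define A where "A = antideriv f"
  have A: "primitive_on 0 (2 * pi) A f" unfolding A_def by (rule antideriv_primitive[OF f])
  have Ai: "integrable torus A" by (rule primitive_on_integrable[OF A])
  have A0: "A (2 * pi) = A 0" unfolding A_def by (rule antideriv_endpoints[OF f f0])
  define Q where "Q = (\<lambda>x. F x - A x - mean F)"
  have Qi: "integrable torus Q" unfolding Q_def using F Ai by simp
  have "(LINT x|torus. Q x) = (LINT x|torus. F x) - (LINT x|torus. A x) - 2 * pi * mean F"
    unfolding Q_def using F Ai by simp
  then have Q0: "(LINT x|torus. Q x) = 0"
    using integral_antideriv[OF f] by (simp add: mean_def A_def)
  have "AE x in torus. Q x = 0"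
  proof (rule trig_poly_complete[OF Qi])
    fix T assume T: "trig_poly T"
    then obtain S m where S: "trig_poly S" and dS: "\<And>x. (S has_real_derivative T x - m) (at x)"
      using trig_poly_antideriv by blast
    define T' where "T' = (\<lambda>x. T x - m)"
    have cont: "continuous_on {0..2*pi} T'" unfolding T'_def
      by (intro continuous_intros trig_poly_continuous T)
    have prim: "primitive_on 0 (2 * pi) S T'"
      by (rule primitive_on_C1[OF _ cont]) (use dS in \<open>simp add: T'_def\<close>)
    have S0: "S (2 * pi) = S 0" using trig_poly_periodic[OF S, of 0] by simp
    have "deriv S = T'" using dS unfolding T'_def by (intro ext DERIV_imp_deriv)
    then have 1: "(LINT x|torus. f x * S x) = - (LINT x|torus. F x * T' x)"
      using weak[OF trig_poly_test_function[OF S]] by (simp add: distr_def ddx_def)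
    have i: "integrable torus (\<lambda>x. f x * S x)" "integrable torus (\<lambda>x. A x * T' x)"
      "integrable torus (\<lambda>x. F x * T' x)" "integrable torus T'"
      using integrable_mult_continuous[OF f trig_poly_continuous[OF S]]
        integrable_mult_continuous[OF Ai cont] integrable_mult_continuous[OF F cont]
        primitive_onD(1)[OF prim] by auto
    have 2: "(LINT x|torus. f x * S x) + (LINT x|torus. A x * T' x) = 0"
      using integral_by_parts_primitive[OF A prim] A0 S0 i by simp
    have 3: "(LINT x|torus. T' x) = 0"
      using primitive_on_diff[OF prim, of 0 "2 * pi"] S0 by simp
    have "(LINT x|torus. Q x * T' x)
        = (LINT x|torus. F x * T' x) - (LINT x|torus. A x * T' x) - mean F * (LINT x|torus. T' x)"
      unfolding Q_def left_diff_distrib using i by simp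
    also have "\<dots> = 0" using 1 2 3 by simp
    finally have 4: "(LINT x|torus. Q x * T' x) = 0" .
    have "(LINT x|torus. Q x * T x) = (LINT x|torus. Q x * T' x + m * Q x)"
      by (simp add: T'_def algebra_simps)
    also have "\<dots> = (LINT x|torus. Q x * T' x) + m * (LINT x|torus. Q x)"
      using integrable_mult_continuous[OF Qi cont] Qi by simp
    finally show "(LINT x|torus. Q x * T x) = 0" using 4 Q0 by simp
  qed
  then show "AE x in torus. F x = antideriv f x + mean F"
    by eventually_elim (simp add: Q_def A_def)
qed

text \<open>
  The inequality comes from \<open>0 \<le> (g' + l g tan(l (x - m)))\<^sup>2 = g'\<^sup>2 - l\<^sup>2 g\<^sup>2 + (l g\<^sup>2 tan(l (x - m)))'\<close>.
  For \<open>l < 1\<close> it applies on intervals of length \<open>\<pi>\<close>, and the boundary terms vanish where \<open>g\<close> does.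
\<close>

lemma wirtinger_tan:
  fixes l m :: real
  assumes g: "primitive_on p q g f" and f2: "integrable (lebesgue_on {p..q}) (\<lambda>x. (f x)\<^sup>2)"
    and "p \<le> q" and tan: "\<And>x. x \<in> {p..q} \<Longrightarrow> \<bar>l * (x - m)\<bar> < pi / 2"
  shows "l\<^sup>2 * (LINT x|lebesgue_on {p..q}. (g x)\<^sup>2) \<le> (LINT x|lebesgue_on {p..q}. (f x)\<^sup>2)
    + l * ((g q)\<^sup>2 * tan (l * (q - m)) - (g p)\<^sup>2 * tan (l * (p - m)))"
proof -
  define M where "M = lebesgue_on {p..q}"
  define \<psi> where "\<psi> = (\<lambda>x. l * tan (l * (x - m)))"
  have cos: "cos (l * (x - m)) \<noteq> 0" if "x \<in> {p..q}" for x
    using tan[OF that] by (intro less_imp_neq[symmetric] cos_gt_zero_pi) auto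
  \<comment> \<open>The Riccati equation \<psi>' = l^2 + \<psi>^2 is what makes the mixed term of
    the square (f + g \<psi>)^2 combine with the remaining ones into the derivative \<open>d\<close>
    of g^2 \<psi>.\<close>
  have der: "(\<psi> has_real_derivative l\<^sup>2 + (\<psi> x)\<^sup>2) (at x)" if "x \<in> {p..q}" for x
  proof -
    have "(\<psi> has_real_derivative l * (inverse ((cos (l * (x - m)))\<^sup>2) * l)) (at x)"
      unfolding \<psi>_def using cos[OF that] by (auto intro!: derivative_eq_intros)
    moreover have "inverse ((cos (l * (x - m)))\<^sup>2) = 1 + (tan (l * (x - m)))\<^sup>2"
      using tan_sec[OF cos[OF that]] by (simp add: power_inverse)
    ultimately show ?thesis by (simp add: \<psi>_def power2_eq_square algebra_simps)
  qed
  have contpsi: "continuous_on {p..q} \<psi>"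
    by (meson DERIV_isCont continuous_at_imp_continuous_on der)
  have \<psi>: "primitive_on p q \<psi> (\<lambda>x. l\<^sup>2 + (\<psi> x)\<^sup>2)"
    by (intro primitive_on_C1 der continuous_intros contpsi)
  define d where "d = (\<lambda>x. (f x * g x + g x * f x) * \<psi> x + g x * g x * (l\<^sup>2 + (\<psi> x)\<^sup>2))"
  note gg = primitive_on_mult[OF g g]
  have d: "(LINT x|M. d x) = (g q)\<^sup>2 * \<psi> q - (g p)\<^sup>2 * \<psi> p" "integrable M d"
    using integral_by_parts_primitive[OF gg \<psi> \<open>p \<le> q\<close>] primitive_onD(1)[OF primitive_on_mult[OF gg \<psi>]]
    by (auto simp: M_def d_def power2_eq_square)
  have g2: "integrable M (\<lambda>x. (g x)\<^sup>2)"
    unfolding M_def by (intro continuous_imp_integrable_real continuous_intros primitive_on_continuous[OF g])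
  have "0 \<le> (LINT x|M. (f x + g x * \<psi> x)\<^sup>2)" by simp
  also have "\<dots> = (LINT x|M. (f x)\<^sup>2 + d x - l\<^sup>2 * (g x)\<^sup>2)"
    by (simp add: d_def power2_eq_square algebra_simps)
  also have "\<dots> = (LINT x|M. (f x)\<^sup>2) + (LINT x|M. d x) - l\<^sup>2 * (LINT x|M. (g x)\<^sup>2)"
    using f2[folded M_def] d(2) g2 by simp
  finally show ?thesis unfolding d(1) M_def[symmetric]
    by (simp add: \<psi>_def algebra_simps)
qed

proposition wirtinger:
  assumes F: "primitive_on 0 (2 * pi) F f" and per: "F (2 * pi) = F 0"
    and mean: "(LINT x|torus. F x) = 0" and f2: "integrable torus (\<lambda>x. (f x)\<^sup>2)"
  shows "(LINT x|torus. (F x)\<^sup>2) \<le> (LINT x|torus. (f x)\<^sup>2)"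
proof -
  have cont: "continuous_on {0..2 * pi} F" by (rule primitive_on_continuous[OF F])
  \<comment> \<open>subtracting the common value of \<open>F\<close> at two antipodal points makes it vanish at both\<close>
  have "\<exists>x0\<ge>0. x0 \<le> pi \<and> F (x0 + pi) - F x0 = 0"
  proof -
    have c: "continuous_on {0..pi} (\<lambda>x. F (x + pi) - F x)"
      by (intro continuous_intros continuous_on_compose2[OF cont] continuous_on_subset[OF cont]) auto
    show ?thesis
    proof (cases "F pi \<le> F 0")
      case True
      then show ?thesis using IVT'[OF _ _ _ c, of 0] per by auto
    next
      case False
      then show ?thesis using IVT2'[of "\<lambda>x. F (x + pi) - F x" pi 0 0] c per by auto
    qed
  qed
  then obtain x0 where x0: "0 \<le> x0" "x0 \<le> pi" "F (x0 + pi) = F x0" by auto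
  define c where "c = F x0"
  define g where "g = (\<lambda>x. F x - c)"
  have g: "primitive_on 0 (2 * pi) g f" unfolding g_def by (rule primitive_on_shift[OF F])
  have g2: "integrable torus (\<lambda>x. (g x)\<^sup>2)"
    by (intro continuous_imp_integrable_real continuous_intros primitive_on_continuous[OF g])
  have g0: "g x0 = 0" "g (x0 + pi) = 0" "g (2 * pi) = g 0" using x0 per by (auto simp: g_def c_def)
  have split: "(LINT x|torus. h x) = (LINT x|lebesgue_on {0..x0}. h x)
      + (LINT x|lebesgue_on {x0..x0+pi}. h x) + (LINT x|lebesgue_on {x0+pi..2*pi}. h x)"
    if "integrable torus h" for h :: "real \<Rightarrow> real"
  proof -
    have "integrable (lebesgue_on {0..x0+pi}) h"
      by (rule integrable_subinterval[OF that]) (use x0 in auto)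
    then show ?thesis
      using integral_combine[OF that, of "x0 + pi"] integral_combine[of 0 "x0 + pi" h x0] x0 by simp
  qed
  have l: "l\<^sup>2 * (LINT x|torus. (g x)\<^sup>2) \<le> (LINT x|torus. (f x)\<^sup>2)" if "0 < l" "l < 1" for l
  proof -
    have *: "\<bar>l * y\<bar> < pi / 2" if "- (pi / 2) \<le> y" "y \<le> pi / 2" for y
    proof -
      have "\<bar>l * y\<bar> = l * \<bar>y\<bar>" using \<open>0 < l\<close> by (simp add: abs_mult)
      also have "\<dots> \<le> l * (pi / 2)" using \<open>0 < l\<close> that by (intro mult_left_mono) linarith+
      also have "\<dots> < 1 * (pi / 2)" using \<open>l < 1\<close> by (intro mult_strict_right_mono) auto
      finally show ?thesis by simp
    qed
    have sub: "primitive_on a b g f" "integrable (lebesgue_on {a..b}) (\<lambda>x. (f x)\<^sup>2)"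
      if "0 \<le> a" "b \<le> 2 * pi" for a b
      by (rule primitive_on_subinterval[OF g] integrable_subinterval[OF f2], use that in auto)+
    \<comment> \<open>The tangents are centred at the midpoints of [x0 - pi, x0], [x0, x0 + pi] and
      [x0 + pi, x0 + 2 pi]. The first and the third interval are the same modulo the period, and
      [0, x0] and [x0 + pi, 2 pi] are its two parts; hence the boundary terms at 0 and 2 pi cancel
      by periodicity of \<open>g\<close>.\<close>
    have 1: "l\<^sup>2 * (LINT x|lebesgue_on {0..x0}. (g x)\<^sup>2) \<le> (LINT x|lebesgue_on {0..x0}. (f x)\<^sup>2)
        + l * ((g x0)\<^sup>2 * tan (l * (x0 - (x0 - pi/2))) - (g 0)\<^sup>2 * tan (l * (0 - (x0 - pi/2))))"
      by (rule wirtinger_tan[OF sub(1) sub(2) _ *]) (use x0 in auto)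
    have 2: "l\<^sup>2 * (LINT x|lebesgue_on {x0..x0+pi}. (g x)\<^sup>2) \<le> (LINT x|lebesgue_on {x0..x0+pi}. (f x)\<^sup>2)
        + l * ((g (x0+pi))\<^sup>2 * tan (l * (x0 + pi - (x0 + pi/2))) - (g x0)\<^sup>2 * tan (l * (x0 - (x0 + pi/2))))"
      by (rule wirtinger_tan[OF sub(1) sub(2) _ *]) (use x0 in auto)
    have 3: "l\<^sup>2 * (LINT x|lebesgue_on {x0+pi..2*pi}. (g x)\<^sup>2) \<le> (LINT x|lebesgue_on {x0+pi..2*pi}. (f x)\<^sup>2)
        + l * ((g (2*pi))\<^sup>2 * tan (l * (2*pi - (x0 + 3*pi/2))) - (g (x0+pi))\<^sup>2 * tan (l * (x0 + pi - (x0 + 3*pi/2))))"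
      by (rule wirtinger_tan[OF sub(1) sub(2) _ *]) (use x0 in auto)
    have "2*pi - (x0 + 3*pi/2) = 0 - (x0 - pi/2)" by simp
    with 1 2 3 show ?thesis unfolding split[OF g2] split[OF f2] g0
      by (simp add: distrib_left)
  qed
  have Fi: "integrable torus F" by (rule primitive_on_integrable[OF F])
  have F2: "integrable torus (\<lambda>x. (F x)\<^sup>2)"
    by (intro continuous_imp_integrable_real continuous_intros cont)
  \<comment> \<open>\<open>F\<close> is orthogonal to constants, so the shift by \<open>c\<close>
    can only enlarge the L2 norm.\<close>
  have "(LINT x|torus. (g x)\<^sup>2) = (LINT x|torus. (F x)\<^sup>2 - 2 * c * F x + c\<^sup>2)"
    by (simp add: g_def power2_diff algebra_simps)
  also have "\<dots> = (LINT x|torus. (F x)\<^sup>2) + 2 * pi * c\<^sup>2"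
    using Fi F2 mean by simp
  finally have le: "(LINT x|torus. (F x)\<^sup>2) \<le> (LINT x|torus. (g x)\<^sup>2)" by simp
  \<comment> \<open>The limit of \<open>l\<close> to 1, taken along \<open>l = sqrt z\<close>; at
    \<open>l = 1\<close> itself the tangent is singular at the zeros.\<close>
  have "(LINT x|torus. (g x)\<^sup>2) \<le> (LINT x|torus. (f x)\<^sup>2)"
  proof (rule field_le_mult_one_interval)
    fix z :: real assume "0 < z" "z < 1"
    then show "z * (LINT x|torus. (g x)\<^sup>2) \<le> (LINT x|torus. (f x)\<^sup>2)"
      using l[of "sqrt z"] by simp
  qed
  with le show ?thesis by simp
qed

section \<open>The Hilbert space l2\<close>

lemma square_integrable_rep_l2: "square_integrable (rep_l2 f)"
  using Quotient_rep_reflp[OF Quotient_l2, of f] by (simp add: l2_rel_def)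

lemma abs_rep_l2: "abs_l2 (rep_l2 f) = f"
  by (rule Quotient_abs_rep[OF Quotient_l2])

lemma rep_abs_l2: "square_integrable f \<Longrightarrow> AE x in torus. rep_l2 (abs_l2 f) x = f x"
  using Quotient_rep_abs[OF Quotient_l2, of f] by (simp add: l2_rel_def)

lemma l2_eq_iff: "f = g \<longleftrightarrow> (AE x in torus. rep_l2 f x = rep_l2 g x)"
  using Quotient_rel_rep[OF Quotient_l2, of f g] by (simp add: l2_rel_def square_integrable_rep_l2)

lemma square_integrable_integrable: "square_integrable f \<Longrightarrow> integrable torus f"
  using square_integrable_mult[of f "\<lambda>_. 1"] square_integrable_const[of 1] by simp

lemma square_integrable_borel_measurable: "square_integrable f \<Longrightarrow> f \<in> borel_measurable torus"
  by (simp add: square_integrable_def)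

lemma square_integrable_diff:
  "square_integrable f \<Longrightarrow> square_integrable g \<Longrightarrow> square_integrable (\<lambda>x. f x - g x)"
  using square_integrable_add[OF _ square_integrable_scale[of g "-1"]] by simp

lemma square_integrable_continuous: "continuous_on {0..2 * pi} f \<Longrightarrow> square_integrable f"
  unfolding square_integrable_def
  by (intro conjI borel_measurable_integrable continuous_imp_integrable_real continuous_intros)

lemma rep_l2_add: "AE x in torus. rep_l2 (f + g) x = rep_l2 f x + rep_l2 g x"
  unfolding plus_l2_def map_fun_apply
  by (intro rep_abs_l2 square_integrable_add square_integrable_rep_l2)

lemma rep_l2_diff: "AE x in torus. rep_l2 (f - g) x = rep_l2 f x - rep_l2 g x"
  unfolding minus_l2_def map_fun_apply
  by (intro rep_abs_l2 square_integrable_diff square_integrable_rep_l2)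

lemma rep_l2_scaleR: "AE x in torus. rep_l2 (c *\<^sub>R f) x = c * rep_l2 f x"
  unfolding scaleR_l2_def map_fun_apply id_apply
  by (intro rep_abs_l2 square_integrable_scale square_integrable_rep_l2)

lemma rep_l2_const: "AE x in torus. rep_l2 (const_l2 c) x = c"
  unfolding const_l2_def map_fun_apply id_apply
  by (intro rep_abs_l2 square_integrable_const)

lemma inner_l2: "inner f g = (LINT x|torus. rep_l2 f x * rep_l2 g x) / (2 * pi)"
  by (simp add: inner_l2_def)

lemma inner_l2_AE:
  assumes "AE x in torus. rep_l2 f x = F x" "AE x in torus. rep_l2 g x = G x"
    "square_integrable F" "square_integrable G"
  shows "inner f g = (LINT x|torus. F x * G x) / (2 * pi)"
proof -
  have "(LINT x|torus. rep_l2 f x * rep_l2 g x) = (LINT x|torus. F x * G x)"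
    using assms square_integrable_rep_l2[of f] square_integrable_rep_l2[of g]
    by (intro integral_cong_AE borel_measurable_times square_integrable_borel_measurable)
      (auto elim: eventually_elim2)
  then show ?thesis by (simp add: inner_l2)
qed

lemma inner_abs_l2:
  assumes "square_integrable F" "square_integrable G"
  shows "inner (abs_l2 F) (abs_l2 G) = (LINT x|torus. F x * G x) / (2 * pi)"
  by (rule inner_l2_AE[OF rep_abs_l2[OF assms(1)] rep_abs_l2[OF assms(2)] assms])

lemma norm_abs_l2:
  "square_integrable F \<Longrightarrow> (norm (abs_l2 F))\<^sup>2 = (LINT x|torus. (F x)\<^sup>2) / (2 * pi)"
  unfolding power2_norm_eq_inner by (simp add: inner_abs_l2 power2_eq_square)

lemma norm_l2_square: "(norm f)\<^sup>2 = (LINT x|torus. (rep_l2 f x)\<^sup>2) / (2 * pi)"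
  by (metis abs_rep_l2 norm_abs_l2 square_integrable_rep_l2)

lemma const_l2_scaleR: "const_l2 c = c *\<^sub>R const_l2 1"
  unfolding l2_eq_iff using rep_l2_const[of c] rep_l2_const[of 1] rep_l2_scaleR[of c "const_l2 1"]
  by eventually_elim simp

lemma inner_const_l2: "inner f (const_l2 c) = c * mean (rep_l2 f)"
  using inner_l2_AE[OF AE_I2 rep_l2_const[of c], of f "rep_l2 f"]
  by (simp add: mean_def square_integrable_rep_l2 square_integrable_const)

lemma inner_const_l2_1: "inner f (const_l2 1) = mean (rep_l2 f)"
  by (simp add: inner_const_l2)

lemma norm_const_l2_1 [simp]: "norm (const_l2 1) = 1"
proof -
  have "(norm (const_l2 1))\<^sup>2 = (LINT x|torus. 1 * 1) / (2 * pi)"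
    unfolding power2_norm_eq_inner
    by (intro inner_l2_AE rep_l2_const square_integrable_const)
  then have "(norm (const_l2 1))\<^sup>2 = 1" by simp
  then show ?thesis by (simp add: power2_eq_1_iff) (metis norm_ge_zero neg_0_le_iff_le not_one_le_zero)
qed

lemma inner_const_l2_1_1 [simp]: "inner (const_l2 1) (const_l2 1) = 1"
  using norm_const_l2_1 by (metis norm_eq_1)

section \<open>Completeness of \<open>l2\<close>\<close>

text \<open>Cauchy-Schwarz against the constant 1. It passes the Cauchy property to L1, where a
  subsequence converging almost everywhere can be extracted.\<close>

lemma L1_le_L2: "(LINT x|torus. \<bar>rep_l2 f x\<bar>) \<le> 2 * pi * norm f"
proof -
  have sq: "square_integrable (\<lambda>x. \<bar>rep_l2 f x\<bar>)"
  proof -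
    have [measurable]: "rep_l2 f \<in> borel_measurable torus"
      by (intro square_integrable_borel_measurable square_integrable_rep_l2)
    have "(\<lambda>x. \<bar>rep_l2 f x\<bar>) \<in> borel_measurable torus" by measurable
    then show ?thesis using square_integrable_rep_l2[of f] unfolding square_integrable_def power2_abs by simp
  qed
  have "(norm (abs_l2 (\<lambda>x. \<bar>rep_l2 f x\<bar>)))\<^sup>2 = (norm f)\<^sup>2"
    unfolding norm_abs_l2[OF sq] norm_l2_square[of f] power2_abs ..
  then have "norm (abs_l2 (\<lambda>x. \<bar>rep_l2 f x\<bar>)) = norm f"
    by (rule power2_eq_imp_eq) simp_all
  moreover have "(LINT x|torus. \<bar>rep_l2 f x\<bar>) / (2 * pi) = inner (abs_l2 (\<lambda>x. \<bar>rep_l2 f x\<bar>)) (const_l2 1)"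
    using inner_l2_AE[OF rep_abs_l2[OF sq] rep_l2_const[of 1] sq square_integrable_const] by simp
  ultimately have "(LINT x|torus. \<bar>rep_l2 f x\<bar>) / (2 * pi) \<le> norm f"
    using norm_cauchy_schwarz[of "abs_l2 (\<lambda>x. \<bar>rep_l2 f x\<bar>)" "const_l2 1"] by simp
  then show ?thesis by (simp add: field_simps)
qed

lemma nn_integral_diff_rep:
  "(\<integral>\<^sup>+ x. ennreal ((rep_l2 f x - rep_l2 g x)\<^sup>2) \<partial>torus) = ennreal (2 * pi * (norm (f - g))\<^sup>2)"
proof -
  have sq: "square_integrable (\<lambda>x. rep_l2 f x - rep_l2 g x)"
    by (intro square_integrable_diff square_integrable_rep_l2)
  have "f - g = abs_l2 (\<lambda>x. rep_l2 f x - rep_l2 g x)" by (simp add: minus_l2_def)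
  then have "(norm (f - g))\<^sup>2 = (LINT x|torus. (rep_l2 f x - rep_l2 g x)\<^sup>2) / (2 * pi)"
    using norm_abs_l2[OF sq] by simp
  then show ?thesis
    using sq by (subst nn_integral_eq_integral) (auto simp: square_integrable_def)
qed

text \<open>Riesz-Fischer: the limit \<open>G\<close> is defined pointwise along a subsequence that
  converges almost everywhere, and Fatou's lemma controls its distance to every late member of the
  sequence.\<close>

instance l2 :: complete_space
proof
  fix X :: "nat \<Rightarrow> l2" assume X: "Cauchy X"
  define s where "s = (\<lambda>n. rep_l2 (X n))"
  have s: "square_integrable (s n)" for n unfolding s_def by (rule square_integrable_rep_l2)
  have meas[measurable]: "s n \<in> borel_measurable torus" for n
    by (intro square_integrable_borel_measurable s)
  have int: "integrable torus (s n)" for n by (rule square_integrable_integrable[OF s])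
  have L1: "\<exists>N. \<forall>i\<ge>N. \<forall>j\<ge>N. LINT x|torus. norm (s i x - s j x) < e" if pos: "e > 0" for e
  proof -
    obtain N where N: "\<And>i j. i \<ge> N \<Longrightarrow> j \<ge> N \<Longrightarrow> norm (X i - X j) < e / (2 * pi)"
      using CauchyD[OF X, of "e / (2 * pi)"] pos by auto
    have "(LINT x|torus. norm (s i x - s j x)) < e" if "i \<ge> N" "j \<ge> N" for i j
    proof -
      have "(LINT x|torus. norm (s i x - s j x)) = (LINT x|torus. \<bar>rep_l2 (X i - X j) x\<bar>)"
      proof (rule integral_cong_AE)
        show "AE x in torus. norm (s i x - s j x) = \<bar>rep_l2 (X i - X j) x\<bar>"
          using rep_l2_diff[of "X i" "X j"] by eventually_elim (simp add: s_def)
      qed (use square_integrable_borel_measurable[OF square_integrable_rep_l2] in auto)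
      also have "\<dots> \<le> 2 * pi * norm (X i - X j)" by (rule L1_le_L2)
      also have "\<dots> < e" using N[OF that] by (simp add: field_simps)
      finally show ?thesis .
    qed
    then show ?thesis by blast
  qed
  obtain r where r: "strict_mono r" "AE x in torus. Cauchy (\<lambda>i. s (r i) x)"
    by (rule cauchy_L1_AE_cauchy_subseq[OF int L1]) (assumption, rule that)
  define G where "G = (\<lambda>x. lim (\<lambda>i. s (r i) x))"
  have G[measurable]: "G \<in> borel_measurable torus" unfolding G_def by measurable
  have lim: "AE x in torus. (\<lambda>i. s (r i) x) \<longlonglongrightarrow> G x"
    using r(2) by eventually_elim (simp add: G_def Cauchy_convergent_iff convergent_LIMSEQ_iff)
  \<comment> \<open>Stated for nonnegative integrals because square integrability of
    \<open>G\<close> is not yet known; the finite bound is what yields it.\<close>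
  have fatou: "(\<integral>\<^sup>+ x. ennreal ((G x - s n x)\<^sup>2) \<partial>torus) \<le> ennreal (2 * pi * e\<^sup>2)"
    if N: "\<And>i. i \<ge> N \<Longrightarrow> norm (X i - X n) < e" for e N n
  proof -
    have "(\<integral>\<^sup>+ x. ennreal ((G x - s n x)\<^sup>2) \<partial>torus)
        = (\<integral>\<^sup>+ x. liminf (\<lambda>i. ennreal ((s (r i) x - s n x)\<^sup>2)) \<partial>torus)"
    proof (rule nn_integral_cong_AE)
      show "AE x in torus. ennreal ((G x - s n x)\<^sup>2) = liminf (\<lambda>i. ennreal ((s (r i) x - s n x)\<^sup>2))"
        using lim
      proof eventually_elim
        case (elim x)
        then have "(\<lambda>i. ennreal ((s (r i) x - s n x)\<^sup>2)) \<longlonglongrightarrow> ennreal ((G x - s n x)\<^sup>2)"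
          by (intro tendsto_ennrealI tendsto_intros)
        then show ?case by (intro lim_imp_Liminf[symmetric] trivial_limit_sequentially)
      qed
    qed
    also have "\<dots> \<le> liminf (\<lambda>i. \<integral>\<^sup>+ x. ennreal ((s (r i) x - s n x)\<^sup>2) \<partial>torus)"
      by (rule nn_integral_liminf) measurable
    also have "\<dots> \<le> ennreal (2 * pi * e\<^sup>2)"
    proof (rule Liminf_le)
      show "\<forall>\<^sub>F i in sequentially. (\<integral>\<^sup>+ x. ennreal ((s (r i) x - s n x)\<^sup>2) \<partial>torus) \<le> ennreal (2 * pi * e\<^sup>2)"
        using eventually_ge_at_top[of N]
      proof eventually_elim
        case (elim i)
        then have "norm (X (r i) - X n) < e"
          using N seq_suble[OF r(1), of i] by (meson le_trans)
        then have "(norm (X (r i) - X n))\<^sup>2 \<le> e\<^sup>2" by (intro power_mono) auto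
        then show ?case unfolding s_def nn_integral_diff_rep by (intro ennreal_leI) simp
      qed
    qed simp
    finally show ?thesis .
  qed
  have GsI: "square_integrable (\<lambda>x. G x - s n x) \<and> (LINT x|torus. (G x - s n x)\<^sup>2) \<le> 2 * pi * e\<^sup>2"
    if "\<And>i. i \<ge> N \<Longrightarrow> norm (X i - X n) < e" for e N n
  proof
    have "(\<integral>\<^sup>+ x. ennreal ((G x - s n x)\<^sup>2) \<partial>torus) < \<infinity>"
      using le_less_trans[OF fatou[OF that]] by simp
    then have "integrable torus (\<lambda>x. (G x - s n x)\<^sup>2)"
      by (intro integrableI_nonneg) auto
    then show 1: "square_integrable (\<lambda>x. G x - s n x)" by (simp add: square_integrable_def)
    show "(LINT x|torus. (G x - s n x)\<^sup>2) \<le> 2 * pi * e\<^sup>2"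
      using fatou[OF that] 1
      by (subst (asm) nn_integral_eq_integral) (auto simp: square_integrable_def ennreal_le_iff)
  qed
  \<comment> \<open>Only differences of \<open>G\<close> to members of the sequence are controlled,
    so \<open>G\<close> is recovered by adding \<open>s N0\<close> back.\<close>
  obtain N0 where "\<And>i. i \<ge> N0 \<Longrightarrow> norm (X i - X N0) < 1" using CauchyD[OF X, of 1] by auto
  from conjunct1[OF GsI[OF this]] have Gsq: "square_integrable G"
    using square_integrable_add[OF _ s[of N0], of "\<lambda>x. G x - s N0 x"] by simp
  have "X \<longlonglongrightarrow> abs_l2 G"
  proof (rule LIMSEQ_I)
    fix e :: real assume "e > 0"
    then obtain N where N: "\<And>i j. i \<ge> N \<Longrightarrow> j \<ge> N \<Longrightarrow> norm (X i - X j) < e / 2"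
      using CauchyD[OF X, of "e / 2"] by auto
    have "norm (X n - abs_l2 G) < e" if "n \<ge> N" for n
    proof -
      have *: "\<And>i. i \<ge> N \<Longrightarrow> norm (X i - X n) < e / 2" using N that by auto
      have "AE x in torus. rep_l2 (abs_l2 G - X n) x = G x - s n x"
        using rep_l2_diff[of "abs_l2 G" "X n"] rep_abs_l2[OF Gsq]
        by eventually_elim (simp add: s_def)
      from inner_l2_AE[OF this this conjunct1[OF GsI[OF *]] conjunct1[OF GsI[OF *]]]
      have "(norm (abs_l2 G - X n))\<^sup>2 = (LINT x|torus. (G x - s n x)\<^sup>2) / (2 * pi)"
        unfolding power2_norm_eq_inner by (simp add: power2_eq_square)
      also have "\<dots> \<le> (e / 2)\<^sup>2" using conjunct2[OF GsI[OF *]] by (simp add: field_simps)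
      finally have "norm (abs_l2 G - X n) \<le> e / 2"
        by (rule power2_le_imp_le) (use \<open>e > 0\<close> in simp)
      then show ?thesis using \<open>e > 0\<close> by (simp add: norm_minus_commute)
    qed
    then show "\<exists>N. \<forall>n\<ge>N. norm (X n - abs_l2 G) < e" by blast
  qed
  then show "convergent X" by (rule convergentI)
qed

instance l2 :: banach ..

section \<open>The anti-derivative as an operator\<close>

lemma AE_lebesgue_on_subset:
  assumes "AE x in lebesgue_on T. P x" "S \<subseteq> T" "S \<in> sets lebesgue" "T \<in> sets lebesgue"
  shows "AE x in lebesgue_on S. P x"
  using assms by (auto simp: AE_restrict_space_iff elim: eventually_mono)

text \<open>The equation for \<open>h\<close> is only required almost everywhere: a representative
  of a linear combination in \<open>l2\<close> need not be the linear combination of the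
  representatives.\<close>

lemma primitive_on_lincomb:
  assumes F: "primitive_on a b F f" and G: "primitive_on a b G g"
    and h: "integrable (lebesgue_on {a..b}) h"
    and eq: "AE x in lebesgue_on {a..b}. h x = c * f x + d * g x"
  shows "primitive_on a b (\<lambda>x. c * F x + d * G x) h"
  unfolding primitive_on_def
proof (intro conjI ballI h)
  fix x assume x: "x \<in> {a..b}"
  have sub: "{a..x} \<subseteq> {a..b}" using x by auto
  have i: "integrable (lebesgue_on {a..x}) f" "integrable (lebesgue_on {a..x}) g"
    "integrable (lebesgue_on {a..x}) h"
    using integrable_subinterval[OF primitive_onD(1)[OF F] sub]
      integrable_subinterval[OF primitive_onD(1)[OF G] sub] integrable_subinterval[OF h sub] by auto
  have "(LINT y|lebesgue_on {a..x}. h y) = (LINT y|lebesgue_on {a..x}. c * f y + d * g y)"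
    using i by (intro integral_cong_AE AE_lebesgue_on_subset[OF eq sub]) auto
  also have "\<dots> = c * (LINT y|lebesgue_on {a..x}. f y) + d * (LINT y|lebesgue_on {a..x}. g y)"
    using i by simp
  finally show "c * F x + d * G x = c * F a + d * G a + (LINT y|lebesgue_on {a..x}. h y)"
    unfolding primitive_onD(2)[OF F x] primitive_onD(2)[OF G x] by (simp add: algebra_simps)
qed

lemma antideriv_unique:
  assumes F: "primitive_on 0 (2 * pi) F f" and "(LINT x|torus. F x) = 0" and x: "x \<in> {0..2 * pi}"
  shows "antideriv f x = F x"
proof -
  define d where "d = antideriv f 0 - F 0"
  note f = primitive_onD(1)[OF F]
  have *: "antideriv f x = F x + d" if "x \<in> {0..2 * pi}" for x
    using primitive_onD(2)[OF F that] primitive_onD(2)[OF antideriv_primitive[OF f] that]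
    unfolding d_def by linarith
  have "(LINT x|torus. antideriv f x) = (LINT x|torus. F x + d)"
    by (intro Bochner_Integration.integral_cong) (auto simp: *)
  also have "\<dots> = 2 * pi * d" using primitive_on_integrable[OF F] assms(2) by simp
  finally have "d = 0" using integral_antideriv[OF f] by simp
  with *[OF x] show ?thesis by simp
qed

definition antideriv_l2 :: "l2 \<Rightarrow> l2" where
  "antideriv_l2 f = abs_l2 (antideriv (rep_l2 f))"

lemma integrable_rep_l2: "integrable torus (rep_l2 f)"
  by (intro square_integrable_integrable square_integrable_rep_l2)

lemma primitive_antideriv_rep: "primitive_on 0 (2 * pi) (antideriv (rep_l2 f)) (rep_l2 f)"
  by (intro antideriv_primitive integrable_rep_l2)

lemma square_integrable_antideriv: "square_integrable (antideriv (rep_l2 f))"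
  by (rule square_integrable_continuous[OF primitive_on_continuous[OF primitive_antideriv_rep]])

lemma rep_antideriv_l2: "AE x in torus. rep_l2 (antideriv_l2 f) x = antideriv (rep_l2 f) x"
  unfolding antideriv_l2_def by (intro rep_abs_l2 square_integrable_antideriv)

lemma antideriv_l2_lincomb:
  "antideriv_l2 (c *\<^sub>R f + d *\<^sub>R g) = c *\<^sub>R antideriv_l2 f + d *\<^sub>R antideriv_l2 g"
proof -
  let ?h = "c *\<^sub>R f + d *\<^sub>R g"
  let ?A = "\<lambda>x. c * antideriv (rep_l2 f) x + d * antideriv (rep_l2 g) x"
  have "AE x in torus. rep_l2 ?h x = c * rep_l2 f x + d * rep_l2 g x"
    using rep_l2_add[of "c *\<^sub>R f" "d *\<^sub>R g"] rep_l2_scaleR[of c f] rep_l2_scaleR[of d g]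
    by eventually_elim simp
  then have A: "primitive_on 0 (2 * pi) ?A (rep_l2 ?h)"
    by (rule primitive_on_lincomb[OF primitive_antideriv_rep primitive_antideriv_rep integrable_rep_l2])
  have "(LINT x|torus. ?A x) = 0"
    using primitive_on_integrable[OF primitive_antideriv_rep]
    by (simp add: integral_antideriv integrable_rep_l2)
  note eq = antideriv_unique[OF A this]
  have "AE x in torus. x \<in> {0..2 * pi}" by (rule AE_I2) auto
  with rep_antideriv_l2[of ?h] rep_antideriv_l2[of f] rep_antideriv_l2[of g]
    rep_l2_add[of "c *\<^sub>R antideriv_l2 f" "d *\<^sub>R antideriv_l2 g"]
    rep_l2_scaleR[of c "antideriv_l2 f"] rep_l2_scaleR[of d "antideriv_l2 g"]
  show ?thesis unfolding l2_eq_iff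
    by eventually_elim (use eq in simp)
qed

lemma linear_antideriv_l2: "linear antideriv_l2"
proof (rule linearI)
  show "antideriv_l2 (f + g) = antideriv_l2 f + antideriv_l2 g" for f g
    using antideriv_l2_lincomb[of 1 f 1 g] by simp
  show "antideriv_l2 (c *\<^sub>R f) = c *\<^sub>R antideriv_l2 f" for c f
    using antideriv_l2_lincomb[of c f 0 0] by simp
qed

lemma mean_zero_iff: "inner f (const_l2 1) = 0 \<longleftrightarrow> (LINT x|torus. rep_l2 f x) = 0"
  by (simp add: inner_const_l2_1 mean_def)

text \<open>Mean zero of \<open>f\<close> and \<open>g\<close> makes both anti-derivatives periodic,
  so integration by parts leaves no boundary terms.\<close>

lemma antideriv_l2_skew:
  assumes "inner f (const_l2 1) = 0" "inner g (const_l2 1) = 0"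
  shows "inner (antideriv_l2 f) g = - inner f (antideriv_l2 g)"
proof -
  let ?f = "rep_l2 f" and ?g = "rep_l2 g"
  note F = primitive_antideriv_rep[of f] and G = primitive_antideriv_rep[of g]
  have i: "integrable torus (\<lambda>x. ?f x * antideriv ?g x)" "integrable torus (\<lambda>x. antideriv ?f x * ?g x)"
    by (intro square_integrable_mult square_integrable_rep_l2 square_integrable_antideriv)+
  have "(LINT x|torus. ?f x * antideriv ?g x) + (LINT x|torus. antideriv ?f x * ?g x) = 0" (is "?I + ?J = 0")
    using integral_by_parts_primitive[OF F G] i
      antideriv_endpoints[OF integrable_rep_l2, of f] antideriv_endpoints[OF integrable_rep_l2, of g] assms
    by (simp add: mean_zero_iff)
  then have "?J = - ?I" by linarith
  moreover have "inner (antideriv_l2 f) g = ?J / (2 * pi)"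
    by (intro inner_l2_AE rep_antideriv_l2 square_integrable_antideriv square_integrable_rep_l2) simp
  moreover have "inner f (antideriv_l2 g) = ?I / (2 * pi)"
    by (intro inner_l2_AE rep_antideriv_l2 square_integrable_antideriv square_integrable_rep_l2) simp
  ultimately show ?thesis by simp
qed

lemma norm_antideriv_l2_le:
  assumes "inner f (const_l2 1) = 0"
  shows "norm (antideriv_l2 f) \<le> norm f"
proof -
  have "(LINT x|torus. (antideriv (rep_l2 f) x)\<^sup>2) \<le> (LINT x|torus. (rep_l2 f x)\<^sup>2)"
  proof (rule wirtinger[OF primitive_antideriv_rep])
    show "antideriv (rep_l2 f) (2 * pi) = antideriv (rep_l2 f) 0"
      using assms by (intro antideriv_endpoints integrable_rep_l2) (simp add: mean_zero_iff)
    show "(LINT x|torus. antideriv (rep_l2 f) x) = 0"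
      by (intro integral_antideriv integrable_rep_l2)
    show "integrable torus (\<lambda>x. (rep_l2 f x)\<^sup>2)"
      using square_integrable_rep_l2[of f] by (simp add: square_integrable_def)
  qed
  then have "(norm (antideriv_l2 f))\<^sup>2 \<le> (norm f)\<^sup>2"
    unfolding antideriv_l2_def norm_abs_l2[OF square_integrable_antideriv] norm_l2_square[of f]
    by (simp add: divide_right_mono)
  then show ?thesis by (rule power2_le_imp_le) simp
qed

text \<open>Wirtinger's inequality applies only to the part of mean zero; the constant part
  contributes the norm of the anti-derivative of 1. Only finiteness of this bound matters: it lets
  the energy be differentiated in time and passed to limits.\<close>

lemma bounded_linear_antideriv_l2: "bounded_linear antideriv_l2"
proof (intro bounded_linear_intro[where K = "1 + norm (antideriv_l2 (const_l2 1))"])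
  interpret linear antideriv_l2 by (rule linear_antideriv_l2)
  fix f :: l2
  show "antideriv_l2 (f + g) = antideriv_l2 f + antideriv_l2 g" for g by (rule add)
  show "antideriv_l2 (c *\<^sub>R f) = c *\<^sub>R antideriv_l2 f" for c by (rule scale)
  define m where "m = inner f (const_l2 1)"
  let ?g = "f - m *\<^sub>R const_l2 1"
  have g0: "inner ?g (const_l2 1) = 0" by (simp add: inner_diff_left m_def)
  have "inner ?g ?g = inner f f - m\<^sup>2"
    by (simp add: inner_diff_left inner_diff_right m_def power2_eq_square inner_commute)
  then have "(norm ?g)\<^sup>2 \<le> (norm f)\<^sup>2" by (simp add: power2_norm_eq_inner)
  then have g: "norm ?g \<le> norm f" by (rule power2_le_imp_le) simp
  have m: "\<bar>m\<bar> \<le> norm f" using Cauchy_Schwarz_ineq2[of f "const_l2 1"] by (simp add: m_def)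
  have "antideriv_l2 f = antideriv_l2 ?g + m *\<^sub>R antideriv_l2 (const_l2 1)"
    by (simp add: diff scale)
  then have "norm (antideriv_l2 f) \<le> norm (antideriv_l2 ?g) + \<bar>m\<bar> * norm (antideriv_l2 (const_l2 1))"
    by (metis norm_scaleR norm_triangle_ineq)
  also have "\<dots> \<le> norm f + norm f * norm (antideriv_l2 (const_l2 1))"
    by (intro add_mono mult_right_mono m order.trans[OF norm_antideriv_l2_le[OF g0] g]) simp
  finally show "norm (antideriv_l2 f) \<le> norm f * (1 + norm (antideriv_l2 (const_l2 1)))"
    by (simp add: distrib_left)
qed

lemma energy_eq:
  "energy \<theta> f g h = (norm f)\<^sup>2 + (norm g)\<^sup>2 + (norm h)\<^sup>2 - \<theta> * inner (antideriv_l2 f) g"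
proof -
  have "inner (antideriv_l2 f) g = (LINT x|torus. antideriv (rep_l2 f) x * rep_l2 g x) / (2 * pi)"
    by (intro inner_l2_AE rep_antideriv_l2 square_integrable_antideriv square_integrable_rep_l2) simp
  then show ?thesis by (simp add: energy_def)
qed

section \<open>Weak derivatives in \<open>l2\<close>\<close>

definition weak_deriv_l2 :: "l2 \<Rightarrow> l2 \<Rightarrow> bool" where
  "weak_deriv_l2 f f' \<longleftrightarrow> (\<forall>\<phi>. test_function \<phi> \<longrightarrow> distr (rep_l2 f') \<phi> = ddx (distr (rep_l2 f)) \<phi>)"

lemma test_function_deriv: "test_function \<phi> \<Longrightarrow> (\<phi> has_real_derivative deriv \<phi> x) (at x)"
  unfolding test_function_def
  by (metis DERIV_deriv_iff_real_differentiable funpow_0)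

lemma test_function_continuous: "test_function \<phi> \<Longrightarrow> continuous_on A \<phi>"
  by (meson DERIV_isCont continuous_at_imp_continuous_on test_function_deriv)

lemma test_function_deriv_continuous: "test_function \<phi> \<Longrightarrow> continuous_on A (deriv \<phi>)"
proof -
  assume "test_function \<phi>"
  then have "(deriv ^^ 1) \<phi> differentiable (at x)" for x unfolding test_function_def by blast
  then show ?thesis
    by (simp add: continuous_at_imp_continuous_on differentiable_imp_continuous_within)
qed

lemma distr_inner:
  assumes "continuous_on {0..2 * pi} \<phi>" "square_integrable F"
  shows "distr F \<phi> = 2 * pi * inner (abs_l2 F) (abs_l2 \<phi>)"
  unfolding distr_def
  by (subst inner_abs_l2) (auto intro: assms square_integrable_continuous)

lemma distr_rep_inner:
  assumes "continuous_on {0..2 * pi} \<phi>"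
  shows "distr (rep_l2 f) \<phi> = 2 * pi * inner f (abs_l2 \<phi>)"
  using distr_inner[OF assms square_integrable_rep_l2, of f] by (simp add: abs_rep_l2)

lemma weak_deriv_l2_iff:
  "weak_deriv_l2 f f' \<longleftrightarrow>
    (\<forall>\<phi>. test_function \<phi> \<longrightarrow> inner f' (abs_l2 \<phi>) = - inner f (abs_l2 (deriv \<phi>)))"
proof -
  have *: "2 * pi * x = - (2 * pi * y) \<longleftrightarrow> x = - y" for x y :: real
    using mult_cancel_left[of "2 * pi" x "- y"] by simp
  show ?thesis
    unfolding weak_deriv_l2_def ddx_def
    by (simp add: distr_rep_inner test_function_continuous test_function_deriv_continuous *)
qed

lemma weak_deriv_l2_const: "weak_deriv_l2 (const_l2 1) 0"
  unfolding weak_deriv_l2_iff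
proof (intro allI impI)
  fix \<phi> assume \<phi>: "test_function \<phi>"
  have "primitive_on 0 (2 * pi) \<phi> (deriv \<phi>)"
    by (intro primitive_on_C1 test_function_deriv test_function_deriv_continuous \<phi>)
  then have "(LINT x|torus. deriv \<phi> x) = \<phi> (0 + 2 * pi) - \<phi> 0"
    by (subst primitive_on_diff) auto
  moreover have "\<phi> (0 + 2 * pi) = \<phi> 0" using \<phi> unfolding test_function_def by blast
  ultimately have "(LINT x|torus. deriv \<phi> x) = 0" by simp
  moreover have "square_integrable (deriv \<phi>)"
    by (intro square_integrable_continuous test_function_deriv_continuous \<phi>)
  ultimately show "inner 0 (abs_l2 \<phi>) = - inner (const_l2 1) (abs_l2 (deriv \<phi>))"
    using inner_l2_AE[OF rep_l2_const rep_abs_l2 square_integrable_const, of "deriv \<phi>" 1] by simp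
qed

lemma weak_deriv_l2_antideriv:
  assumes "weak_deriv_l2 f f'"
  shows "inner f' (const_l2 1) = 0"
    and "f = antideriv_l2 f' + inner f (const_l2 1) *\<^sub>R const_l2 1"
proof -
  have weak: "distr (rep_l2 f') \<phi> = ddx (distr (rep_l2 f)) \<phi>" if "test_function \<phi>" for \<phi>
    using assms that unfolding weak_deriv_l2_def by blast
  show "inner f' (const_l2 1) = 0"
    using weak_derivative_antideriv(1)[OF integrable_rep_l2 integrable_rep_l2 weak] by (simp add: mean_zero_iff)
  have "AE x in torus. rep_l2 f x = antideriv (rep_l2 f') x + mean (rep_l2 f)"
    using weak_derivative_antideriv(2)[OF integrable_rep_l2 integrable_rep_l2 weak] by blast
  then show "f = antideriv_l2 f' + inner f (const_l2 1) *\<^sub>R const_l2 1"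
    unfolding l2_eq_iff const_l2_scaleR[symmetric]
    using rep_l2_add[of "antideriv_l2 f'" "const_l2 (inner f (const_l2 1))"]
      rep_l2_const[of "inner f (const_l2 1)"] rep_antideriv_l2[of f']
    by eventually_elim (simp add: inner_const_l2_1)
qed

lemma antideriv_l2_weak_deriv:
  "weak_deriv_l2 f f' \<Longrightarrow> antideriv_l2 f' = f - inner f (const_l2 1) *\<^sub>R const_l2 1"
  using weak_deriv_l2_antideriv(2)[of f f'] by (simp add: algebra_simps)

text \<open>Skewness of the anti-derivative on \<open>f'\<close> and \<open>g'\<close>, which both
  have mean zero; for the same reason the means of \<open>f\<close> and \<open>g\<close> drop
  out.\<close>

lemma weak_deriv_l2_skew:
  assumes f: "weak_deriv_l2 f f'" and g: "weak_deriv_l2 g g'"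
  shows "inner f g' = - inner f' g"
  using antideriv_l2_skew[OF weak_deriv_l2_antideriv(1)[OF f] weak_deriv_l2_antideriv(1)[OF g]]
    weak_deriv_l2_antideriv(1)[OF f] weak_deriv_l2_antideriv(1)[OF g]
  by (simp add: antideriv_l2_weak_deriv[OF f] antideriv_l2_weak_deriv[OF g]
      inner_diff_left inner_diff_right inner_commute[of "const_l2 1"])

text \<open>Applied to sqrt(2/3) u1 + u3 / sqrt 3, this is how the mixed term of the energy yields
  dissipation of the first component.\<close>

lemma antideriv_weak_deriv_l2_inner:
  assumes f: "inner f (const_l2 1) = 0" and g: "weak_deriv_l2 g g'"
  shows "inner (antideriv_l2 f) g' = - inner f g"
  using antideriv_l2_skew[OF f weak_deriv_l2_antideriv(1)[OF g]] f
  by (simp add: antideriv_l2_weak_deriv[OF g] inner_diff_right)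

lemma test_functions_l2_eqI:
  assumes "\<And>\<phi>. test_function \<phi> \<Longrightarrow> inner f (abs_l2 \<phi>) = inner g (abs_l2 \<phi>)"
  shows "f = g"
proof -
  have "distr (rep_l2 (f - g)) \<phi> = 0" if "test_function \<phi>" for \<phi>
    using assms[OF that] by (simp add: distr_rep_inner test_function_continuous that inner_diff_left)
  then have "AE x in torus. rep_l2 (f - g) x = 0"
    by (intro test_function_0_eq_AE integrable_rep_l2)
  then show ?thesis
    unfolding l2_eq_iff using rep_l2_diff[of f g] by eventually_elim simp
qed

section \<open>Averages of orbits of semigroups\<close>

text \<open>Brings a derivative into the form of the one-sided difference quotient by which
  \<open>generator\<close> is defined.\<close>

lemma has_vector_derivative_right_limit:
  fixes f :: "real \<Rightarrow> 'a::real_normed_vector"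
  assumes "(f has_vector_derivative d) (at t within {0..})" "t \<ge> 0"
  shows "((\<lambda>k. (f (t + k) - f t) /\<^sub>R k) \<longlongrightarrow> d) (at_right 0)"
proof -
  have "(f has_vector_derivative d) (at_right t)"
    by (rule has_vector_derivative_within_subset[OF assms(1)]) (use assms(2) in auto)
  then have "((\<lambda>y. (1 / norm (y - t)) *\<^sub>R (f y - (f t + (y - t) *\<^sub>R d))) \<longlongrightarrow> 0) (at_right t)"
    unfolding has_vector_derivative_def has_derivative_within by simp
  then have "((\<lambda>k. (1 / norm (k + t - t)) *\<^sub>R (f (k + t) - (f t + (k + t - t) *\<^sub>R d))) \<longlongrightarrow> 0) (at_right 0)"
    unfolding at_right_to_0[of t] filterlim_filtermap by simp
  moreover have "\<forall>\<^sub>F k in at_right 0.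
      (1 / norm (k + t - t)) *\<^sub>R (f (k + t) - (f t + (k + t - t) *\<^sub>R d)) = (f (t + k) - f t) /\<^sub>R k - d"
    unfolding eventually_at_right_field
    by (intro exI[of _ 1]) (auto simp: scaleR_diff_right scaleR_add_right add.commute divide_inverse)
  ultimately have "((\<lambda>k. (f (t + k) - f t) /\<^sub>R k - d) \<longlongrightarrow> 0) (at_right 0)"
    by (rule Lim_transform_eventually)
  then show ?thesis by (rule LIM_zero_cancel)
qed

text \<open>The average over [t, t + h], written with the fixed lower limit 0 so that both terms are
  values of one primitive of \<open>u\<close>.\<close>

definition orbit_average :: "(real \<Rightarrow> 'a::banach) \<Rightarrow> real \<Rightarrow> real \<Rightarrow> 'a" where
  "orbit_average u h t = (integral {0..t + h} u - integral {0..t} u) /\<^sub>R h"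

context
  fixes T :: "real \<Rightarrow> 'a::banach \<Rightarrow>\<^sub>L 'a" and u :: "real \<Rightarrow> 'a" and x :: 'a
  assumes T: "C0_semigroup T" and u: "\<And>t. t \<ge> 0 \<Longrightarrow> u t = T t x" and cont: "continuous_on {0..} u"
begin

lemma orbit_integral_deriv:
  assumes "t \<ge> 0"
  shows "((\<lambda>t. integral {0..t} u) has_vector_derivative u t) (at t within {0..})"
proof -
  have "((\<lambda>t. integral {0..t} u) has_vector_derivative u t) (at t within {0..t + 1})"
    by (rule integral_has_vector_derivative[OF continuous_on_subset[OF cont]]) (use assms in auto)
  moreover have "at t within {0..t + 1} = at t within {0..}"
    by (rule at_within_nhd[of t "{..<t + 1}"]) auto
  ultimately show ?thesis by simp
qed

lemma orbit_average_deriv: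
  assumes "t \<ge> 0" "h > 0"
  shows "(orbit_average u h has_vector_derivative (u (t + h) - u t) /\<^sub>R h) (at t within {0..})"
proof -
  have "((\<lambda>t. t + h) has_vector_derivative 1) (at t within {0..})"
    by (auto intro!: derivative_eq_intros)
  moreover have "((\<lambda>t. integral {0..t} u) has_vector_derivative u (t + h)) (at (t + h) within (\<lambda>t. t + h) ` {0..})"
    by (rule has_vector_derivative_within_subset[OF orbit_integral_deriv]) (use assms in auto)
  ultimately have "((\<lambda>t. integral {0..t + h} u) has_vector_derivative u (t + h)) (at t within {0..})"
    using vector_diff_chain_within[of "\<lambda>t. t + h" 1 t "{0..}" "\<lambda>t. integral {0..t} u" "u (t + h)"]
    by (simp add: o_def)
  from has_vector_derivative_diff[OF this orbit_integral_deriv[OF assms(1)]]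
  show ?thesis unfolding orbit_average_def[abs_def]
    by (rule bounded_linear.has_vector_derivative[OF bounded_linear_scaleR_right])
qed

lemma orbit_average_tendsto:
  assumes "t \<ge> 0"
  shows "((\<lambda>h. orbit_average u h t) \<longlongrightarrow> u t) (at_right 0)"
  unfolding orbit_average_def
  by (rule has_vector_derivative_right_limit[OF orbit_integral_deriv[OF assms] assms])

lemma orbit_integrable: "a \<ge> 0 \<Longrightarrow> u integrable_on {a..b}"
  by (intro integrable_continuous_real continuous_on_subset[OF cont]) auto

text \<open>The bounded operator \<open>T k\<close> passes under the integral, and the semigroup law
  moves the orbit by \<open>k\<close>.\<close>

lemma orbit_shift:
  assumes "t \<ge> 0" "k \<ge> 0"
  shows "T k (integral {0..t} u) = integral {0..t + k} u - integral {0..k} u"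
proof -
  have "T k (integral {0..t} u) = integral {0..t} (blinfun_apply (T k) \<circ> u)"
    by (rule integral_linear[symmetric]) (auto intro!: orbit_integrable blinfun.bounded_linear_right)
  also have "\<dots> = integral {0..t} (u \<circ> (+) k)"
    using T assms by (intro Henstock_Kurzweil_Integration.integral_cong) (auto simp: C0_semigroup_def u)
  also have "\<dots> = integral {k..t + k} u"
    using integral_shift_Icc_real[of 0 t u k] by simp
  also have "\<dots> = integral {0..t + k} u - integral {0..k} u"
    using Henstock_Kurzweil_Integration.integral_combine[of 0 k "t + k" u] orbit_integrable[of 0 "t + k"] assms
    by (simp add: algebra_simps)
  finally show ?thesis .
qed

text \<open>The semigroup maps the average at time t to the average at time t + k, so the quotient
  in the definition of the generator is the difference quotient of the average in time.\<close>

lemma orbit_average_generator: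
  assumes "t \<ge> 0" "h > 0"
  shows "(orbit_average u h t, (u (t + h) - u t) /\<^sub>R h) \<in> generator T"
proof -
  have "T k (orbit_average u h t) = orbit_average u h (t + k)" if "k > 0" for k
    using that assms
    by (simp add: orbit_average_def blinfun.scaleR_right blinfun.diff_right orbit_shift add_ac)
  then have "\<forall>\<^sub>F k in at_right 0. (orbit_average u h (t + k) - orbit_average u h t) /\<^sub>R k
      = (T k (orbit_average u h t) - orbit_average u h t) /\<^sub>R k"
    unfolding eventually_at_right_field by (intro exI[of _ 1]) auto
  from Lim_transform_eventually[OF
      has_vector_derivative_right_limit[OF orbit_average_deriv[OF assms] assms(1)] this]
  show ?thesis unfolding generator_def by simp
qed

end

section \<open>The damping operator\<close>

lemma AE_torus_ex:
  assumes "AE x in torus. P x"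
  shows "\<exists>x. P x"
proof (rule ccontr)
  assume "\<nexists>x. P x"
  with assms have "AE x in torus. False" by simp
  then have "emeasure torus (space torus) = 0" by (metis ae_filter_eq_bot_iff eventually_False)
  then show False by (simp add: emeasure_restrict_space)
qed

lemma L_infinity_bounded:
  assumes "L_infinity \<sigma>"
  shows "\<exists>C. AE x in torus. \<bar>\<sigma> x\<bar> \<le> C"
proof -
  have AE: "AE x in torus. ereal \<bar>\<sigma> x\<bar> \<le> esssup torus (\<lambda>x. ereal \<bar>\<sigma> x\<bar>)" by (rule esssup_AE)
  have "esssup torus (\<lambda>x. ereal \<bar>\<sigma> x\<bar>) \<noteq> \<infinity>" using assms by (auto simp: L_infinity_def)
  with AE show ?thesis
    by (cases "esssup torus (\<lambda>x. ereal \<bar>\<sigma> x\<bar>)") auto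
qed

lemma ess_inf_sup_bounds:
  assumes \<sigma>: "L_infinity \<sigma>" and pos: "ess_inf \<sigma> > 0"
  shows "AE x in torus. ess_inf \<sigma> \<le> \<sigma> x \<and> \<sigma> x \<le> ess_sup \<sigma>"
proof -
  have [measurable]: "\<sigma> \<in> borel_measurable torus" using \<sigma> by (simp add: L_infinity_def)
  define m where "m = Liminf (ae_filter torus) (\<lambda>x. ereal (\<sigma> x))"
  define M where "M = esssup torus (\<lambda>x. ereal (\<sigma> x))"
  have "esssup torus (\<lambda>x. - ereal (\<sigma> x)) = - m"
    unfolding esssup_def m_def using ereal_Limsup_uminus[of "ae_filter torus" "\<lambda>x. ereal (\<sigma> x)"] by simp
  then have "AE x in torus. - ereal (\<sigma> x) \<le> - m" using esssup_AE[of "\<lambda>x. - ereal (\<sigma> x)" torus] by simp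
  then have lower: "AE x in torus. m \<le> ereal (\<sigma> x)"
    by eventually_elim (simp add: ereal_minus_le_minus del: uminus_ereal.simps)
  \<comment> \<open>\<open>real_of_ereal\<close> sends both infinities to 0, so a positive value
    certifies that \<open>m\<close> is finite.\<close>
  have m: "m = ereal (ess_inf \<sigma>)"
    using pos unfolding ess_inf_def m_def[symmetric] by (cases m) auto
  have upper: "AE x in torus. ereal (\<sigma> x) \<le> M" unfolding M_def by (rule esssup_AE)
  obtain C where "AE x in torus. \<bar>\<sigma> x\<bar> \<le> C" using L_infinity_bounded[OF \<sigma>] by blast
  then have "M \<le> ereal C" unfolding M_def by (intro esssup_I) (auto elim: eventually_mono)
  \<comment> \<open>One point satisfying both bounds, available because the torus has positive
    measure, excludes that \<open>M\<close> is minus infinity.\<close>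
  moreover obtain x where "m \<le> ereal (\<sigma> x)" "ereal (\<sigma> x) \<le> M"
    using AE_torus_ex[OF eventually_conj[OF lower upper]] by blast
  ultimately have M: "M = ereal (ess_sup \<sigma>)"
    unfolding ess_sup_def M_def[symmetric] using m by (cases M) auto
  show ?thesis using lower upper unfolding m M by eventually_elim simp
qed

definition mult_l2 :: "(real \<Rightarrow> real) \<Rightarrow> l2 \<Rightarrow> l2" where
  "mult_l2 \<sigma> f = abs_l2 (\<lambda>x. \<sigma> x * rep_l2 f x)"

lemma square_integrable_L_infinity_mult:
  assumes \<sigma>: "L_infinity \<sigma>" and f: "square_integrable f"
  shows "square_integrable (\<lambda>x. \<sigma> x * f x)"
proof -
  obtain C where C: "AE x in torus. \<bar>\<sigma> x\<bar> \<le> C" using L_infinity_bounded[OF \<sigma>] by blast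
  have [measurable]: "\<sigma> \<in> borel_measurable torus" "f \<in> borel_measurable torus"
    using \<sigma> f by (auto simp: L_infinity_def square_integrable_def)
  have "integrable torus (\<lambda>x. (\<sigma> x * f x)\<^sup>2)"
  proof (rule Bochner_Integration.integrable_bound)
    show "integrable torus (\<lambda>x. C\<^sup>2 * (f x)\<^sup>2)" using f by (simp add: square_integrable_def)
    show "AE x in torus. norm ((\<sigma> x * f x)\<^sup>2) \<le> norm (C\<^sup>2 * (f x)\<^sup>2)"
      using C
    proof eventually_elim
      case (elim x)
      then have "(\<sigma> x)\<^sup>2 \<le> C\<^sup>2" by (metis abs_ge_zero power2_abs power_mono)
      then show ?case by (simp add: power_mult_distrib mult_right_mono)
    qed
  qed measurable
  then show ?thesis by (simp add: square_integrable_def)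
qed

lemma mult_l2_lower:
  assumes \<sigma>: "L_infinity \<sigma>" and s: "AE x in torus. s \<le> \<sigma> x"
  shows "s * (norm f)\<^sup>2 \<le> inner (mult_l2 \<sigma> f) f"
proof -
  let ?f = "rep_l2 f"
  have sq: "square_integrable (\<lambda>x. \<sigma> x * ?f x)"
    by (intro square_integrable_L_infinity_mult \<sigma> square_integrable_rep_l2)
  have "s * (LINT x|torus. (?f x)\<^sup>2) = (LINT x|torus. s * (?f x)\<^sup>2)" by simp
  also have "\<dots> \<le> (LINT x|torus. \<sigma> x * ?f x * ?f x)"
  proof (rule integral_mono_AE)
    show "integrable torus (\<lambda>x. s * (?f x)\<^sup>2)"
      using square_integrable_rep_l2[of f] by (simp add: square_integrable_def)
    show "integrable torus (\<lambda>x. \<sigma> x * ?f x * ?f x)"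
      by (intro square_integrable_mult sq square_integrable_rep_l2)
    show "AE x in torus. s * (?f x)\<^sup>2 \<le> \<sigma> x * ?f x * ?f x"
      using s by eventually_elim (simp add: power2_eq_square mult.assoc mult_right_mono)
  qed
  also have "\<dots> = 2 * pi * inner (mult_l2 \<sigma> f) f"
    using inner_abs_l2[OF sq square_integrable_rep_l2, of f] by (simp add: mult_l2_def abs_rep_l2)
  finally show ?thesis unfolding norm_l2_square by (simp add: field_simps)
qed

text \<open>The multiplier \<sigma> - \<alpha> lies in [0, S], so subtracting \<alpha> does not
  enlarge the constant S. This lets the mixed term of \<alpha> times the energy be absorbed for
  free.\<close>

lemma mult_l2_upper:
  assumes \<sigma>: "L_infinity \<sigma>" and s: "AE x in torus. \<alpha> \<le> \<sigma> x \<and> \<sigma> x \<le> S" and "\<alpha> \<ge> 0"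
  shows "norm (mult_l2 \<sigma> f - \<alpha> *\<^sub>R f) \<le> S * norm f"
proof -
  let ?f = "rep_l2 f"
  have S: "S \<ge> 0" using AE_torus_ex[OF s] \<open>\<alpha> \<ge> 0\<close> by auto
  have sq: "square_integrable (\<lambda>x. \<sigma> x * ?f x)"
    by (intro square_integrable_L_infinity_mult \<sigma> square_integrable_rep_l2)
  have sq': "square_integrable (\<lambda>x. \<sigma> x * ?f x - \<alpha> * ?f x)"
    by (intro square_integrable_diff sq square_integrable_scale square_integrable_rep_l2)
  have "AE x in torus. rep_l2 (mult_l2 \<sigma> f - \<alpha> *\<^sub>R f) x = \<sigma> x * ?f x - \<alpha> * ?f x"
    using rep_l2_diff[of "mult_l2 \<sigma> f" "\<alpha> *\<^sub>R f"] rep_abs_l2[OF sq] rep_l2_scaleR[of \<alpha> f]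
    unfolding mult_l2_def by eventually_elim simp
  from inner_l2_AE[OF this this sq' sq']
  have "(norm (mult_l2 \<sigma> f - \<alpha> *\<^sub>R f))\<^sup>2 = (LINT x|torus. (\<sigma> x * ?f x - \<alpha> * ?f x)\<^sup>2) / (2 * pi)"
    unfolding power2_norm_eq_inner by (simp add: power2_eq_square)
  also have "\<dots> \<le> (LINT x|torus. S\<^sup>2 * (?f x)\<^sup>2) / (2 * pi)"
  proof (intro divide_right_mono integral_mono_AE)
    show "integrable torus (\<lambda>x. S\<^sup>2 * (?f x)\<^sup>2)"
      using square_integrable_rep_l2[of f] by (simp add: square_integrable_def)
    show "integrable torus (\<lambda>x. (\<sigma> x * ?f x - \<alpha> * ?f x)\<^sup>2)"
      using sq' by (simp add: square_integrable_def)
    show "AE x in torus. (\<sigma> x * ?f x - \<alpha> * ?f x)\<^sup>2 \<le> S\<^sup>2 * (?f x)\<^sup>2"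
      using s
    proof eventually_elim
      case (elim x)
      then have "(\<sigma> x - \<alpha>)\<^sup>2 \<le> S\<^sup>2" using \<open>\<alpha> \<ge> 0\<close> by (intro power_mono) auto
      then have "(\<sigma> x - \<alpha>)\<^sup>2 * (?f x)\<^sup>2 \<le> S\<^sup>2 * (?f x)\<^sup>2" by (intro mult_right_mono) auto
      then show ?case by (simp add: left_diff_distrib flip: power_mult_distrib)
    qed
  qed simp
  also have "\<dots> = (S * norm f)\<^sup>2" by (simp add: power_mult_distrib norm_l2_square)
  finally show ?thesis by (rule power2_le_imp_le) (use S in simp)
qed

section \<open>Dissipation of the energy\<close>

lemma weak_deriv_l2_lincomb:
  assumes "weak_deriv_l2 f f'" "weak_deriv_l2 g g'"
  shows "weak_deriv_l2 (c *\<^sub>R f + d *\<^sub>R g) (c *\<^sub>R f' + d *\<^sub>R g')"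
  using assms by (simp add: weak_deriv_l2_iff inner_add_left)

text \<open>On the maximal domain the first component determines the weak derivative of
  \<open>u2\<close>, which then reappears in the third; the second component gives a weak derivative
  of a u1 + b u3 only, not of the two summands.\<close>

lemma wave_operator_l2:
  assumes \<sigma>: "L_infinity \<sigma>" and uv: "((u1, u2, u3), (v1, v2, v3)) \<in> wave_operator \<sigma>"
  defines "a \<equiv> sqrt (2/3)" and "b \<equiv> 1 / sqrt 3"
  obtains g' p' where "weak_deriv_l2 u2 g'" "weak_deriv_l2 (a *\<^sub>R u1 + b *\<^sub>R u3) p'"
    "v1 = - a *\<^sub>R g'" "v2 = - p' - mult_l2 \<sigma> u2" "v3 = - b *\<^sub>R g' - mult_l2 \<sigma> u3"
proof -
  have a: "a > 0" by (simp add: a_def)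
  let ?S = "mult_l2 \<sigma>"
  have eqs: "inner v1 (abs_l2 \<phi>) = a * inner u2 (abs_l2 (deriv \<phi>))"
    "inner v2 (abs_l2 \<phi>) = a * inner u1 (abs_l2 (deriv \<phi>)) + b * inner u3 (abs_l2 (deriv \<phi>))
      - inner (?S u2) (abs_l2 \<phi>)"
    "inner v3 (abs_l2 \<phi>) = b * inner u2 (abs_l2 (deriv \<phi>)) - inner (?S u3) (abs_l2 \<phi>)"
    if \<phi>: "test_function \<phi>" for \<phi>
  proof -
    note c = test_function_continuous[OF \<phi>] test_function_deriv_continuous[OF \<phi>]
    have S: "distr (\<lambda>x. \<sigma> x * rep_l2 f x) \<phi> = 2 * pi * inner (?S f) (abs_l2 \<phi>)" for f
      unfolding mult_l2_def
      by (intro distr_inner c square_integrable_L_infinity_mult \<sigma> square_integrable_rep_l2)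
    have *: "2 * pi * x = 2 * pi * y \<Longrightarrow> x = y" for x y :: real by simp
    have "distr (rep_l2 v1) \<phi> = a * distr (rep_l2 u2) (deriv \<phi>)"
      "distr (rep_l2 v2) \<phi> = a * distr (rep_l2 u1) (deriv \<phi>) + b * distr (rep_l2 u3) (deriv \<phi>)
        - distr (\<lambda>x. \<sigma> x * rep_l2 u2 x) \<phi>"
      "distr (rep_l2 v3) \<phi> = b * distr (rep_l2 u2) (deriv \<phi>) - distr (\<lambda>x. \<sigma> x * rep_l2 u3 x) \<phi>"
      using uv \<phi> unfolding wave_operator_def ddx_def a_def b_def by auto
    note h = this[unfolded S distr_rep_inner[OF c(1)] distr_rep_inner[OF c(2)]]
    show "inner v1 (abs_l2 \<phi>) = a * inner u2 (abs_l2 (deriv \<phi>))"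
      by (rule *) (simp only: h mult.left_commute)
    show "inner v2 (abs_l2 \<phi>) = a * inner u1 (abs_l2 (deriv \<phi>)) + b * inner u3 (abs_l2 (deriv \<phi>))
        - inner (?S u2) (abs_l2 \<phi>)"
      by (rule *) (simp only: h right_diff_distrib distrib_left mult.left_commute)
    show "inner v3 (abs_l2 \<phi>) = b * inner u2 (abs_l2 (deriv \<phi>)) - inner (?S u3) (abs_l2 \<phi>)"
      by (rule *) (simp only: h right_diff_distrib mult.left_commute)
  qed
  \<comment> \<open>Solves v1 = - a g' for the weak derivative of \<open>u2\<close>.\<close>
  define g' where "g' = (- 1 / a) *\<^sub>R v1"
  define p' where "p' = - v2 - ?S u2"
  have v1: "v1 = - a *\<^sub>R g'" using a by (simp add: g'_def)
  show thesis
  proof (rule that[of g' p', OF _ _ v1])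
    show "weak_deriv_l2 u2 g'"
      unfolding weak_deriv_l2_iff g'_def using a by (simp add: eqs)
    show "weak_deriv_l2 (a *\<^sub>R u1 + b *\<^sub>R u3) p'"
      unfolding weak_deriv_l2_iff p'_def by (simp add: eqs inner_add_left inner_diff_left)
    show "v2 = - p' - ?S u2" by (simp add: p'_def)
    show "v3 = - b *\<^sub>R g' - ?S u3"
    proof (rule test_functions_l2_eqI)
      fix \<phi> assume "test_function \<phi>"
      then show "inner v3 (abs_l2 \<phi>) = inner (- b *\<^sub>R g' - ?S u3) (abs_l2 \<phi>)"
        using a by (simp add: eqs g'_def inner_diff_left)
    qed
  qed
qed

text \<open>Young's inequality for each product, with weights that use up \<open>c1\<close> and
  \<open>c2\<close> completely; the hypothesis says that the two costs in F^2 fit into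
  \<open>c3\<close>.\<close>

lemma quadratic_form_bound:
  fixes c1 c2 c3 d1 d2 F G K :: real
  assumes "c1 > 0" "c2 > 0" and "d1\<^sup>2 / (4 * c1) + d2\<^sup>2 / (4 * c2) \<le> c3"
  shows "d1 * (F * G) + d2 * (F * K) \<le> c1 * G\<^sup>2 + c2 * K\<^sup>2 + c3 * F\<^sup>2"
proof -
  have amgm: "d * (F * G) \<le> c * G\<^sup>2 + d\<^sup>2 / (4 * c) * F\<^sup>2" if "c > 0" for c d G :: real
  proof -
    have "0 \<le> (2 * c * G - d * F)\<^sup>2 / (4 * c)" using that by simp
    also have "\<dots> = c * G\<^sup>2 + d\<^sup>2 / (4 * c) * F\<^sup>2 - d * (F * G)"
      using that by (simp add: field_simps power2_eq_square)
    finally show ?thesis by simp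
  qed
  have "(d1\<^sup>2 / (4 * c1) + d2\<^sup>2 / (4 * c2)) * F\<^sup>2 \<le> c3 * F\<^sup>2"
    by (rule mult_right_mono[OF assms(3)]) simp
  with amgm[OF assms(1), of d1 G] amgm[OF assms(2), of d2 K] show ?thesis
    unfolding distrib_right by linarith
qed

text \<open>The left side is the time derivative of the energy at a state (f, g, k) with velocity
  (v1, v2, v3). Here \<open>f\<close> is already the first component minus its mean.\<close>

lemma energy_dissipation:
  fixes \<theta> \<alpha> s S :: real
  defines "a \<equiv> sqrt (2/3)" and "b \<equiv> 1 / sqrt 3"
  assumes \<sigma>: "L_infinity \<sigma>" and bounds: "AE x in torus. s \<le> \<sigma> x \<and> \<sigma> x \<le> S"
    and pos: "\<theta> > 0" "\<alpha> > 0"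
    and cond1: "a * \<theta> + \<alpha> < 2 * s" and cond2: "\<alpha> \<le> a * \<theta>"
    and cond3: "\<theta>\<^sup>2 * S\<^sup>2 / (8 * s - 4 * a * \<theta> - 4 * \<alpha>) + \<theta>\<^sup>2 / (12 * (2 * s - \<alpha>)) \<le> a * \<theta> - \<alpha>"
    and f: "inner f (const_l2 1) = 0"
    and g: "weak_deriv_l2 g g'" and p: "weak_deriv_l2 (a *\<^sub>R f + b *\<^sub>R k) p'"
    and v1: "v1 = - a *\<^sub>R g'" and v2: "v2 = - p' - mult_l2 \<sigma> g"
    and v3: "v3 = - b *\<^sub>R g' - mult_l2 \<sigma> k"
  shows "2 * (inner f v1 + inner g v2 + inner k v3)
      - \<theta> * (inner (antideriv_l2 v1) g + inner (antideriv_l2 f) v2) \<le> - \<alpha> * energy \<theta> f g k"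
proof -
  let ?M = "mult_l2 \<sigma>" and ?J = antideriv_l2
  interpret J: linear ?J by (rule linear_antideriv_l2)
  \<comment> \<open>Chaining the first two conditions gives 2 \<alpha> \<le> a \<theta> + \<alpha> <
    2 s. This makes \<sigma> - \<alpha> nonnegative below.\<close>
  have \<alpha>s: "\<alpha> \<le> s" using cond1 cond2 by simp
  have a: "a > 0" and b: "b > 0" and b2: "b\<^sup>2 = 1 / 3"
    by (simp_all add: a_def b_def power_divide)
  define m where "m = inner g (const_l2 1)"
  have sM: "AE x in torus. s \<le> \<sigma> x" using bounds by eventually_elim simp
  have lowg: "s * (norm g)\<^sup>2 \<le> inner (?M g) g" and lowk: "s * (norm k)\<^sup>2 \<le> inner (?M k) k"
    by (intro mult_l2_lower \<sigma> sM)+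
  have "AE x in torus. \<alpha> \<le> \<sigma> x \<and> \<sigma> x \<le> S" using bounds by eventually_elim (use \<alpha>s in auto)
  then have upg: "norm (?M g - \<alpha> *\<^sub>R g) \<le> S * norm g"
    by (rule mult_l2_upper[OF \<sigma>]) (use pos in simp)
  have "inner f v1 + inner g v2 + inner k v3
      = - inner (a *\<^sub>R f + b *\<^sub>R k) g' - inner p' g - inner (?M g) g - inner (?M k) k"
    unfolding v1 v2 v3 by (simp add: inner_diff_right inner_add_left inner_add_right inner_commute)
  also have "\<dots> = - inner (?M g) g - inner (?M k) k"
    using weak_deriv_l2_skew[OF p g] by simp
  finally have 1: "inner f v1 + inner g v2 + inner k v3 = - inner (?M g) g - inner (?M k) k" .
  have "?J v1 = - a *\<^sub>R (g - m *\<^sub>R const_l2 1)"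
    unfolding v1 J.scale antideriv_l2_weak_deriv[OF g] m_def ..
  then have "inner (?J v1) g = - a * ((norm g)\<^sup>2 - m\<^sup>2)"
    by (simp add: inner_diff_left dot_square_norm m_def inner_commute[of "const_l2 1"] power2_eq_square)
  then have 2: "- inner (?J v1) g \<le> a * (norm g)\<^sup>2"
    using a by (simp add: right_diff_distrib)
  have "inner (?J f) v2 = inner f (a *\<^sub>R f + b *\<^sub>R k) - inner (?J f) (?M g)"
    unfolding v2 using antideriv_weak_deriv_l2_inner[OF f p] by (simp add: inner_diff_right)
  then have 3: "inner (?J f) v2 = a * (norm f)\<^sup>2 + b * inner f k - inner (?J f) (?M g)"
    by (simp add: inner_add_right power2_norm_eq_inner)
  \<comment> \<open>The first term stems from the damping of \<open>g\<close>, the second from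
    \<alpha> times the mixed term of the energy; estimated separately they would cost S + \<alpha>
    instead of S.\<close>
  have 4: "inner (?J f) (?M g) - \<alpha> * inner (?J f) g \<le> S * (norm f * norm g)"
  proof -
    have "inner (?J f) (?M g) - \<alpha> * inner (?J f) g = inner (?J f) (?M g - \<alpha> *\<^sub>R g)"
      by (simp add: inner_diff_right)
    also have "\<dots> \<le> norm (?J f) * norm (?M g - \<alpha> *\<^sub>R g)" by (rule norm_cauchy_schwarz)
    also have "\<dots> \<le> norm f * (S * norm g)"
      by (intro mult_mono norm_antideriv_l2_le[OF f] upg) auto
    finally show ?thesis by (simp add: mult_ac)
  qed
  have 5: "- inner f k \<le> norm f * norm k" using norm_cauchy_schwarz[of "- f" k] by simp
  \<comment> \<open>Damping supplies 2 s for \<open>g\<close> and \<open>k\<close>, estimate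
    \<open>2\<close> takes a \<theta> from \<open>g\<close>, identity \<open>3\<close> supplies a
    \<theta> for \<open>f\<close>, and \<alpha> times the energy takes \<alpha> from each. With b^2
    = 1/3 the criterion for this form is \<open>cond3\<close>.\<close>
  have "(\<theta> * S) * (norm f * norm g) + (\<theta> * b) * (norm f * norm k)
      \<le> (2 * s - a * \<theta> - \<alpha>) * (norm g)\<^sup>2 + (2 * s - \<alpha>) * (norm k)\<^sup>2 + (a * \<theta> - \<alpha>) * (norm f)\<^sup>2"
  proof (rule quadratic_form_bound)
    show "0 < 2 * s - a * \<theta> - \<alpha>" "0 < 2 * s - \<alpha>" using cond1 cond2 pos by auto
    have "(\<theta> * S)\<^sup>2 / (4 * (2 * s - a * \<theta> - \<alpha>)) = \<theta>\<^sup>2 * S\<^sup>2 / (8 * s - 4 * a * \<theta> - 4 * \<alpha>)"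
      by (simp add: power_mult_distrib right_diff_distrib mult.assoc)
    moreover have "(\<theta> * b)\<^sup>2 / (4 * (2 * s - \<alpha>)) = \<theta>\<^sup>2 / (12 * (2 * s - \<alpha>))"
      by (simp add: power_mult_distrib b2)
    ultimately show "(\<theta> * S)\<^sup>2 / (4 * (2 * s - a * \<theta> - \<alpha>)) + (\<theta> * b)\<^sup>2 / (4 * (2 * s - \<alpha>)) \<le> a * \<theta> - \<alpha>"
      using cond3 by simp
  qed
  moreover have "\<theta> * (- inner (?J v1) g) \<le> \<theta> * (a * (norm g)\<^sup>2)"
    by (rule mult_left_mono[OF 2]) (use pos in simp)
  moreover have "\<theta> * (inner (?J f) (?M g) - \<alpha> * inner (?J f) g) \<le> \<theta> * (S * (norm f * norm g))"
    by (rule mult_left_mono[OF 4]) (use pos in simp)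
  moreover have "(\<theta> * b) * (- inner f k) \<le> (\<theta> * b) * (norm f * norm k)"
    by (rule mult_left_mono[OF 5]) (use pos b in simp)
  ultimately show ?thesis
    unfolding energy_eq 1 3 using lowg lowk by (simp add: algebra_simps)
qed

section \<open>Exponential decay\<close>

lemma tendsto_energy:
  assumes "(f \<longlongrightarrow> f0) F" "(g \<longlongrightarrow> g0) F" "(h \<longlongrightarrow> h0) F"
  shows "((\<lambda>x. energy \<theta> (f x) (g x) (h x)) \<longlongrightarrow> energy \<theta> f0 g0 h0) F"
  unfolding energy_eq
  by (intro tendsto_intros bounded_linear.tendsto[OF bounded_linear_antideriv_l2] assms)

lemma energy_has_real_derivative:
  assumes f: "(f has_vector_derivative f') (at t)" and g: "(g has_vector_derivative g') (at t)"
    and h: "(h has_vector_derivative h') (at t)"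
  shows "((\<lambda>t. energy \<theta> (f t) (g t) (h t)) has_real_derivative
    2 * (inner (f t) f' + inner (g t) g' + inner (h t) h')
      - \<theta> * (inner (antideriv_l2 f') (g t) + inner (antideriv_l2 (f t)) g')) (at t)"
proof -
  note i = bounded_bilinear.has_vector_derivative[OF bounded_bilinear_inner,
      folded has_real_derivative_iff_has_vector_derivative]
  note J = bounded_linear.has_vector_derivative[OF bounded_linear_antideriv_l2 f]
  show ?thesis unfolding energy_eq power2_norm_eq_inner
    by (rule DERIV_cong[OF DERIV_diff[OF DERIV_add[OF DERIV_add[OF i[OF f f] i[OF g g]] i[OF h h]]
          DERIV_cmult[OF i[OF J g]]]])
      (simp add: inner_commute algebra_simps)
qed

text \<open>The second conclusion records conservation of the mean, from which nonnegativity of the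
  energy is later deduced.\<close>

lemma energy_decay:
  fixes u1 u2 u3 :: "real \<Rightarrow> l2"
  assumes \<sigma>: "L_infinity \<sigma>" and bounds: "AE x in torus. s \<le> \<sigma> x \<and> \<sigma> x \<le> S"
    and cont: "continuous_on {0..} u1" "continuous_on {0..} u2" "continuous_on {0..} u3"
    and mild: "mild_solution (wave_operator \<sigma>) (u10, u20, u30) (\<lambda>t. (u1 t, u2 t, u3 t))"
    and pos: "\<theta> > 0" "\<alpha> > 0"
    and cond: "sqrt (2/3) * \<theta> + \<alpha> < 2 * s" "\<alpha> \<le> sqrt (2/3) * \<theta>"
      "\<theta>\<^sup>2 * S\<^sup>2 / (8 * s - 4 * sqrt (2/3) * \<theta> - 4 * \<alpha>) + \<theta>\<^sup>2 / (12 * (2 * s - \<alpha>))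
        \<le> sqrt (2/3) * \<theta> - \<alpha>"
    and t: "t \<ge> 0"
  shows "energy \<theta> (u1 t - const_l2 (mean (rep_l2 u10))) (u2 t) (u3 t)
    \<le> energy \<theta> (u10 - const_l2 (mean (rep_l2 u10))) u20 u30 * exp (- \<alpha> * t)"
    and "inner (u1 t - const_l2 (mean (rep_l2 u10))) (const_l2 1) = 0"
proof -
  let ?one = "const_l2 1"
  define u where "u = (\<lambda>t. (u1 t, u2 t, u3 t))"
  define c where "c = mean (rep_l2 u10)"
  obtain T where T: "C0_semigroup T" and gen: "generator T = wave_operator \<sigma>"
    and uT: "\<And>t. t \<ge> 0 \<Longrightarrow> u t = T t (u10, u20, u30)"
    using mild unfolding mild_solution_def u_def by blast
  have cu: "continuous_on {0..} u" unfolding u_def by (intro continuous_intros cont)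
  note orbit = T uT cu
  have u0: "u 0 = (u10, u20, u30)" using uT[of 0] T by (simp add: C0_semigroup_def)
  define w where "w = orbit_average u"
  define w1 w2 w3 where "w1 = (\<lambda>h t. fst (w h t))" and "w2 = (\<lambda>h t. fst (snd (w h t)))"
    and "w3 = (\<lambda>h t. snd (snd (w h t)))"
  define d1 d2 d3 where "d1 = (\<lambda>h t. (u1 (t + h) - u1 t) /\<^sub>R h)"
    and "d2 = (\<lambda>h t. (u2 (t + h) - u2 t) /\<^sub>R h)" and "d3 = (\<lambda>h t. (u3 (t + h) - u3 t) /\<^sub>R h)"
  have d: "(u (t + h) - u t) /\<^sub>R h = (d1 h t, d2 h t, d3 h t)" for h t
    by (simp add: u_def d1_def d2_def d3_def)
  have w: "w h t = (w1 h t, w2 h t, w3 h t)" for h t by (simp add: w1_def w2_def w3_def)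
  have wave: "((w1 h t, w2 h t, w3 h t), (d1 h t, d2 h t, d3 h t)) \<in> wave_operator \<sigma>"
    if "t \<ge> 0" "h > 0" for h t
    using orbit_average_generator[OF orbit that] unfolding gen d w_def[symmetric] w .
  have mean_u: "inner (u1 t) ?one = c" if "t \<ge> 0" for t
  proof (cases "t = 0")
    case True
    then show ?thesis using u0 by (simp add: u_def c_def inner_const_l2_1)
  next
    case False
    with that have t: "t > 0" by simp
    \<comment> \<open>The average over the window [0, t]: the operator maps it to (u t - u 0) / t.
      The first component of this is a multiple of a weak derivative, so its mean vanishes, although
      \<open>u\<close> itself need not be differentiable.\<close>
    have "((w1 t 0, w2 t 0, w3 t 0), (d1 t 0, d2 t 0, d3 t 0)) \<in> wave_operator \<sigma>"
      by (rule wave) (use t in simp_all)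
    then obtain g' where "weak_deriv_l2 (w2 t 0) g'" "d1 t 0 = - sqrt (2/3) *\<^sub>R g'"
      using wave_operator_l2[OF \<sigma>] by metis
    then have "inner (d1 t 0) ?one = 0" using weak_deriv_l2_antideriv(1) by simp
    then have "inner (u1 t) ?one = inner (u1 0) ?one"
      using t by (simp add: d1_def inner_diff_left)
    then show ?thesis using u0 by (simp add: u_def c_def inner_const_l2_1)
  qed
  have c: "const_l2 c = c *\<^sub>R ?one" by (rule const_l2_scaleR)
  show "inner (u1 t - const_l2 (mean (rep_l2 u10))) ?one = 0"
    using mean_u[OF t] unfolding c_def[symmetric] c by (simp add: inner_diff_left)
  have mean_w: "inner (w1 h t - c *\<^sub>R ?one) ?one = 0" if "t \<ge> 0" "h > 0" for h t
  proof -
    have bl: "bounded_linear (\<lambda>x :: l2 \<times> l2 \<times> l2. inner (fst x) ?one)"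
      by (intro bounded_linear_intros)
    have int: "inner (fst (integral {0..r} u)) ?one = c * r" if "r \<ge> 0" for r
    proof -
      have "inner (fst (integral {0..r} u)) ?one = integral {0..r} ((\<lambda>x. inner (fst x) ?one) \<circ> u)"
        by (rule integral_linear[OF orbit_integrable[OF orbit] bl, symmetric]) simp_all
      also have "\<dots> = integral {0..r} (\<lambda>_. c)"
        by (intro Henstock_Kurzweil_Integration.integral_cong) (simp add: u_def mean_u)
      finally show ?thesis using that by simp
    qed
    have "inner (w1 h t) ?one = (c * (t + h) - c * t) / h"
      using int[of "t + h"] int[of t] that
      by (simp add: w1_def w_def orbit_average_def inner_diff_left divide_inverse)
    then show ?thesis using that by (simp add: inner_diff_left field_simps)
  qed
  define E where "E = (\<lambda>h t. energy \<theta> (w1 h t - c *\<^sub>R ?one) (w2 h t) (w3 h t))"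
  \<comment> \<open>Gronwall's inequality as monotonicity of the energy times its growth factor.
    Derivatives are needed only inside the interval, where the derivative within {0..} is
    two-sided.\<close>
  have "E h t * exp (\<alpha> * t) \<le> E h 0 * exp (\<alpha> * 0)" if h: "h > 0" for h
  proof (rule DERIV_nonpos_imp_decreasing_open[OF t])
    have w_deriv: "(w h has_vector_derivative (d1 h r, d2 h r, d3 h r)) (at r within {0..})"
      if "r \<ge> 0" for r
      using orbit_average_deriv[OF orbit that h] unfolding d w_def .
    have "continuous_on {0..t} (w h)"
      unfolding continuous_on_eq_continuous_within
    proof
      fix r assume r: "r \<in> {0..t}"
      then have "continuous (at r within {0..}) (w h)"
        by (intro has_vector_derivative_continuous[OF w_deriv]) simp
      then show "continuous (at r within {0..t}) (w h)"
        by (rule continuous_within_subset) (use r in auto)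
    qed
    then have "continuous_on {0..t} (w1 h)" "continuous_on {0..t} (w2 h)" "continuous_on {0..t} (w3 h)"
      unfolding w1_def w2_def w3_def by (intro continuous_intros; assumption)+
    then have "continuous_on {0..t} (E h)"
      unfolding E_def continuous_on_def by (auto intro!: tendsto_energy tendsto_diff)
    then show "continuous_on {0..t} (\<lambda>t. E h t * exp (\<alpha> * t))"
      by (intro continuous_intros)
    fix r assume r: "0 < r" "r < t"
    have "at r within {0..} = at r" using r by (intro at_within_interior) simp
    then have wd: "(w h has_vector_derivative (d1 h r, d2 h r, d3 h r)) (at r)"
      using w_deriv[of r] r by simp
    have "(w1 h has_vector_derivative d1 h r) (at r)" "(w2 h has_vector_derivative d2 h r) (at r)"
      "(w3 h has_vector_derivative d3 h r) (at r)"
      using bounded_linear.has_vector_derivative[OF bounded_linear_fst wd]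
        bounded_linear.has_vector_derivative[OF bounded_linear_fst
          bounded_linear.has_vector_derivative[OF bounded_linear_snd wd]]
        bounded_linear.has_vector_derivative[OF bounded_linear_snd
          bounded_linear.has_vector_derivative[OF bounded_linear_snd wd]]
      unfolding w1_def w2_def w3_def by simp_all
    then have "((\<lambda>t. w1 h t - c *\<^sub>R ?one) has_vector_derivative d1 h r) (at r)"
      "(w2 h has_vector_derivative d2 h r) (at r)" "(w3 h has_vector_derivative d3 h r) (at r)"
      by (simp_all add: has_vector_derivative_diff_const)
    note E_deriv = energy_has_real_derivative[OF this, of \<theta>]
    define D where "D = 2 * (inner (w1 h r - c *\<^sub>R ?one) (d1 h r) + inner (w2 h r) (d2 h r) + inner (w3 h r) (d3 h r))
      - \<theta> * (inner (antideriv_l2 (d1 h r)) (w2 h r) + inner (antideriv_l2 (w1 h r - c *\<^sub>R ?one)) (d2 h r))"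
    have "(E h has_real_derivative D) (at r)" unfolding E_def D_def by (rule E_deriv)
    then have "((\<lambda>t. E h t * exp (\<alpha> * t)) has_real_derivative (D + \<alpha> * E h r) * exp (\<alpha> * r)) (at r)"
      by (auto intro!: derivative_eq_intros simp: algebra_simps)
    moreover from wave[of r h] r h obtain g' p' where
      g: "weak_deriv_l2 (w2 h r) g'"
      and p: "weak_deriv_l2 (sqrt (2/3) *\<^sub>R w1 h r + (1 / sqrt 3) *\<^sub>R w3 h r) p'"
      and v: "d1 h r = - sqrt (2/3) *\<^sub>R g'" "d2 h r = - p' - mult_l2 \<sigma> (w2 h r)"
        "d3 h r = - (1 / sqrt 3) *\<^sub>R g' - mult_l2 \<sigma> (w3 h r)"
      using wave_operator_l2[OF \<sigma>] by (metis less_imp_le)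
    \<comment> \<open>Constants have weak derivative 0, so removing the mean from the first
      component leaves \<open>p'\<close> unchanged.\<close>
    have "weak_deriv_l2 (sqrt (2/3) *\<^sub>R (w1 h r - c *\<^sub>R ?one) + (1 / sqrt 3) *\<^sub>R w3 h r) p'"
      using weak_deriv_l2_lincomb[OF p weak_deriv_l2_const, of 1 "- sqrt (2/3) * c"]
      by (simp add: scaleR_diff_right algebra_simps)
    from energy_dissipation[OF \<sigma> bounds pos cond mean_w g this v] r h
    have "D \<le> - \<alpha> * E h r" unfolding D_def E_def by simp
    then have "(D + \<alpha> * E h r) * exp (\<alpha> * r) \<le> 0"
      by (intro mult_nonpos_nonneg) auto
    ultimately show "\<exists>y. ((\<lambda>t. E h t * exp (\<alpha> * t)) has_real_derivative y) (at r) \<and> y \<le> 0"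
      by blast
  qed
  then have "\<forall>\<^sub>F h in at_right 0. E h t * exp (\<alpha> * t) \<le> E h 0"
    unfolding eventually_at_right_field by (intro exI[of _ 1]) simp
  moreover have lim: "((\<lambda>h. E h t) \<longlongrightarrow> energy \<theta> (u1 t - c *\<^sub>R ?one) (u2 t) (u3 t)) (at_right 0)"
    if "t \<ge> 0" for t
  proof -
    have l: "((\<lambda>h. w h t) \<longlongrightarrow> u t) (at_right 0)"
      unfolding w_def by (rule orbit_average_tendsto[OF orbit that])
    have "((\<lambda>h. w1 h t) \<longlongrightarrow> u1 t) (at_right 0)" "((\<lambda>h. w2 h t) \<longlongrightarrow> u2 t) (at_right 0)"
      "((\<lambda>h. w3 h t) \<longlongrightarrow> u3 t) (at_right 0)"
      using tendsto_fst[OF l] tendsto_fst[OF tendsto_snd[OF l]] tendsto_snd[OF tendsto_snd[OF l]]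
      unfolding w1_def w2_def w3_def by (simp_all add: u_def)
    then show ?thesis unfolding E_def by (intro tendsto_energy tendsto_intros)
  qed
  ultimately have "energy \<theta> (u1 t - c *\<^sub>R ?one) (u2 t) (u3 t) * exp (\<alpha> * t)
      \<le> energy \<theta> (u1 0 - c *\<^sub>R ?one) (u2 0) (u3 0)"
    by (intro tendsto_le[OF _ lim tendsto_mult[OF lim tendsto_const]])
      (use t in \<open>auto simp: trivial_limit_at_right_real\<close>)
  then have "energy \<theta> (u1 t - c *\<^sub>R ?one) (u2 t) (u3 t) \<le> energy \<theta> (u1 0 - c *\<^sub>R ?one) (u2 0) (u3 0) / exp (\<alpha> * t)"
    by (simp add: field_simps)
  then show "energy \<theta> (u1 t - const_l2 (mean (rep_l2 u10))) (u2 t) (u3 t)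
    \<le> energy \<theta> (u10 - const_l2 (mean (rep_l2 u10))) u20 u30 * exp (- \<alpha> * t)"
    using u0 unfolding c_def[symmetric] c by (simp add: u_def exp_minus divide_inverse)
qed

section \<open>Nonnegativity of the energy and the explicit rate\<close>

text \<open>By Wirtinger's inequality the mixed term is at most \<theta> times the product of two
  norms, and 2 is the largest factor for which the squares dominate. Convergence to 0 needs this
  lower bound beside the exponential upper one.\<close>

lemma energy_nonneg:
  assumes "inner f (const_l2 1) = 0" "0 \<le> \<theta>" "\<theta> \<le> 2"
  shows "energy \<theta> f g h \<ge> 0"
proof -
  have "inner (antideriv_l2 f) g \<le> norm (antideriv_l2 f) * norm g" by (rule norm_cauchy_schwarz)
  also have "\<dots> \<le> norm f * norm g" by (intro mult_right_mono norm_antideriv_l2_le assms) simp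
  finally have "\<theta> * inner (antideriv_l2 f) g \<le> \<theta> * (norm f * norm g)" using assms by (intro mult_left_mono)
  also have "\<dots> \<le> 2 * (norm f * norm g)" using assms by (intro mult_right_mono) auto
  also have "\<dots> \<le> (norm f)\<^sup>2 + (norm g)\<^sup>2" using sum_squares_bound[of "norm f" "norm g"] by (simp add: mult.assoc)
  finally have "\<theta> * inner (antideriv_l2 f) g \<le> (norm f)\<^sup>2 + (norm g)\<^sup>2" .
  then show ?thesis unfolding energy_eq using zero_le_power2[of "norm h"] by linarith
qed

text \<open>The choice \<theta> = sqrt 6 \<alpha> turns sqrt(2/3) \<theta> into 2 \<alpha>, so the
  right side of the third condition becomes \<alpha>. The bound 1/2 serves to keep \<theta> below
  2.\<close>

lemma rate_admissible:
  fixes s S \<alpha> :: real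
  assumes "0 < s" "s \<le> S" and \<alpha>: "\<alpha> = min (s / 2) (3 * s / (9 * S\<^sup>2 + 1))"
  shows "0 < \<alpha>" "\<alpha> \<le> 1 / 2" "sqrt (2/3) * (sqrt 6 * \<alpha>) = 2 * \<alpha>"
    "(sqrt 6 * \<alpha>)\<^sup>2 * S\<^sup>2 / (8 * s - 4 * sqrt (2/3) * (sqrt 6 * \<alpha>) - 4 * \<alpha>)
       + (sqrt 6 * \<alpha>)\<^sup>2 / (12 * (2 * s - \<alpha>)) \<le> sqrt (2/3) * (sqrt 6 * \<alpha>) - \<alpha>"
proof -
  have den: "9 * S\<^sup>2 + 1 > 0" by (simp add: add_nonneg_pos)
  then show pos: "0 < \<alpha>" using assms by (simp add: \<alpha>)
  have le1: "2 * \<alpha> \<le> s" by (simp add: \<alpha>)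
  have "\<alpha> \<le> 3 * s / (9 * S\<^sup>2 + 1)" by (simp add: \<alpha>)
  then have le2: "\<alpha> * (9 * S\<^sup>2 + 1) \<le> 3 * s" using den by (simp add: pos_le_divide_eq)
  \<comment> \<open>Yields 3 s / (9 S^2 + 1) \<le> s / (2 S) \<le> 1/2, an upper bound for \<alpha>
    independent of the size of \<sigma>.\<close>
  have "0 \<le> (3 * S - 1)\<^sup>2" by simp
  then have "6 * S \<le> 9 * S\<^sup>2 + 1" by (simp add: power2_diff power_mult_distrib)
  then have "3 * s \<le> (9 * S\<^sup>2 + 1) / 2" using assms by simp
  with le2 have "\<alpha> * (9 * S\<^sup>2 + 1) \<le> 1 / 2 * (9 * S\<^sup>2 + 1)" by simp
  then show "\<alpha> \<le> 1 / 2" using den by (rule mult_right_le_imp_le)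
  have "sqrt (2/3) * sqrt 6 = 2"
    unfolding real_sqrt_mult[symmetric] by simp
  then show eq: "sqrt (2/3) * (sqrt 6 * \<alpha>) = 2 * \<alpha>" by (simp flip: mult.assoc)
  have sq: "(sqrt 6 * \<alpha>)\<^sup>2 = 6 * \<alpha>\<^sup>2" by (simp add: power_mult_distrib)
  \<comment> \<open>Since \<alpha> \<le> s/2, the denominators satisfy 8 s - 12 \<alpha> \<ge> 2 s
    here and 12 (2 s - \<alpha>) \<ge> 18 s in the next estimate.\<close>
  have "6 * \<alpha>\<^sup>2 * S\<^sup>2 / (8 * s - 8 * \<alpha> - 4 * \<alpha>) \<le> 6 * \<alpha>\<^sup>2 * S\<^sup>2 / (2 * s)"
    using le1 assms by (intro divide_left_mono) auto
  moreover have "6 * \<alpha>\<^sup>2 / (12 * (2 * s - \<alpha>)) \<le> 6 * \<alpha>\<^sup>2 / (18 * s)"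
    using le1 assms by (intro divide_left_mono) auto
  \<comment> \<open>The origin of the second entry of the minimum: the sum is at most \<alpha>
    exactly when \<alpha> (9 S^2 + 1) \<le> 3 s.\<close>
  moreover have "6 * \<alpha>\<^sup>2 * S\<^sup>2 / (2 * s) + 6 * \<alpha>\<^sup>2 / (18 * s) = \<alpha> * (\<alpha> * (9 * S\<^sup>2 + 1) / (3 * s))"
    using assms by (simp add: field_simps power2_eq_square)
  moreover have "\<alpha> * (\<alpha> * (9 * S\<^sup>2 + 1) / (3 * s)) \<le> \<alpha> * 1"
    using le2 pos assms by (intro mult_left_mono) auto
  ultimately have main: "6 * \<alpha>\<^sup>2 * S\<^sup>2 / (8 * s - 8 * \<alpha> - 4 * \<alpha>) + 6 * \<alpha>\<^sup>2 / (12 * (2 * s - \<alpha>)) \<le> \<alpha>" by linarith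
  have den_eq: "8 * s - 4 * sqrt (2/3) * (sqrt 6 * \<alpha>) - 4 * \<alpha> = 8 * s - 8 * \<alpha> - 4 * \<alpha>"
    unfolding mult.assoc[of 4] eq by simp
  show "(sqrt 6 * \<alpha>)\<^sup>2 * S\<^sup>2 / (8 * s - 4 * sqrt (2/3) * (sqrt 6 * \<alpha>) - 4 * \<alpha>)
       + (sqrt 6 * \<alpha>)\<^sup>2 / (12 * (2 * s - \<alpha>)) \<le> sqrt (2/3) * (sqrt 6 * \<alpha>) - \<alpha>"
    unfolding sq den_eq eq using main by simp
qed

theorem corollary6p3:
  fixes \<sigma> :: "real \<Rightarrow> real" and \<sigma>min \<sigma>max uinf :: real
    and u1 u2 u3 :: "real \<Rightarrow> l2" and u10 u20 u30 :: l2
  assumes "L_infinity \<sigma>"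
    and "\<sigma>min = ess_inf \<sigma>" and "\<sigma>min > 0" and "\<sigma>max = ess_sup \<sigma>"
    and "continuous_on {0..} u1" and "continuous_on {0..} u2" and "continuous_on {0..} u3"
    and "mild_solution (wave_operator \<sigma>) (u10, u20, u30) (\<lambda>t. (u1 t, u2 t, u3 t))"
    and "uinf = mean (rep_l2 u10)"
  shows "(\<forall>\<theta> \<alpha> :: real.
            \<theta> > 0 \<and> \<alpha> > 0 \<and>
            sqrt (2/3) * \<theta> + \<alpha> < 2 * \<sigma>min \<and>
            \<alpha> \<le> sqrt (2/3) * \<theta> \<and>
            \<theta>\<^sup>2 * \<sigma>max\<^sup>2 / (8 * \<sigma>min - 4 * sqrt (2/3) * \<theta> - 4 * \<alpha>)
              + \<theta>\<^sup>2 / (12 * (2 * \<sigma>min - \<alpha>)) \<le> sqrt (2/3) * \<theta> - \<alpha>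
            \<longrightarrow> (\<forall>t\<ge>0. energy \<theta> (u1 t - const_l2 uinf) (u2 t) (u3 t)
                  \<le> energy \<theta> (u10 - const_l2 uinf) u20 u30 * exp (- \<alpha> * t))) \<and>
         (let \<alpha> = min (\<sigma>min / 2) (3 * \<sigma>min / (9 * \<sigma>max\<^sup>2 + 1)) in
            (\<forall>t\<ge>0. energy (sqrt 6 * \<alpha>) (u1 t - const_l2 uinf) (u2 t) (u3 t)
                  \<le> energy (sqrt 6 * \<alpha>) (u10 - const_l2 uinf) u20 u30 * exp (- \<alpha> * t)) \<and>
            ((\<lambda>t. energy (sqrt 6 * \<alpha>) (u1 t - const_l2 uinf) (u2 t) (u3 t)) \<longlongrightarrow> 0) at_top)"
proof -
  have bounds: "AE x in torus. \<sigma>min \<le> \<sigma> x \<and> \<sigma> x \<le> \<sigma>max"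
    using ess_inf_sup_bounds[OF assms(1)] assms(2-4) by simp
  obtain x where "\<sigma>min \<le> \<sigma> x" "\<sigma> x \<le> \<sigma>max" using AE_torus_ex[OF bounds] by blast
  then have le: "\<sigma>min \<le> \<sigma>max" by simp
  note decay = energy_decay[OF assms(1) bounds assms(5-8), folded assms(9)]
  define \<alpha> where "\<alpha> = min (\<sigma>min / 2) (3 * \<sigma>min / (9 * \<sigma>max\<^sup>2 + 1))"
  note rate = rate_admissible[OF assms(3) le \<alpha>_def]
  let ?E = "\<lambda>t. energy (sqrt 6 * \<alpha>) (u1 t - const_l2 uinf) (u2 t) (u3 t)"
  let ?init = "energy (sqrt 6 * \<alpha>) (u10 - const_l2 uinf) u20 u30"
  have \<alpha>_le: "\<alpha> \<le> \<sigma>min / 2" by (simp add: \<alpha>_def)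
  have cond: "sqrt (2/3) * (sqrt 6 * \<alpha>) + \<alpha> < 2 * \<sigma>min" "\<alpha> \<le> sqrt (2/3) * (sqrt 6 * \<alpha>)"
    "0 < sqrt 6 * \<alpha>"
    unfolding rate(3) using rate(1) \<alpha>_le assms(3) by simp_all
  have special: "?E t \<le> ?init * exp (- \<alpha> * t)" "?E t \<ge> 0" if "t \<ge> 0" for t
  proof -
    show "?E t \<le> ?init * exp (- \<alpha> * t)"
      by (rule decay(1)[OF cond(3) rate(1) cond(1,2) rate(4) that])
    \<comment> \<open>Rounding sqrt 6 up to sqrt 16 = 4 is enough for \<theta> \<le> 2.\<close>
    have "sqrt 6 * \<alpha> \<le> sqrt 16 * (1 / 2)"
      using rate(1,2) by (intro mult_mono real_sqrt_le_mono) auto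
    then have "sqrt 6 * \<alpha> \<le> 2" by simp
    then show "?E t \<ge> 0"
      using decay(2)[OF cond(3) rate(1) cond(1,2) rate(4) that] cond(3)
      by (intro energy_nonneg) auto
  qed
  have "((\<lambda>t. exp (- \<alpha> * t)) \<longlongrightarrow> 0) at_top"
    by (rule filterlim_compose[OF exp_at_bot filterlim_tendsto_neg_mult_at_bot[OF tendsto_const _ filterlim_ident]])
      (use rate(1) in simp)
  then have lim: "((\<lambda>t. ?init * exp (- \<alpha> * t)) \<longlongrightarrow> 0) at_top"
    by (rule tendsto_mult_right_zero)
  have up: "\<forall>\<^sub>F t in at_top. ?E t \<le> ?init * exp (- \<alpha> * t)"
    using eventually_ge_at_top[of 0] by eventually_elim (rule special(1))
  have low: "\<forall>\<^sub>F t in at_top. 0 \<le> ?E t"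
    using eventually_ge_at_top[of 0] by eventually_elim (rule special(2))
  have "(?E \<longlongrightarrow> 0) at_top" by (rule tendsto_sandwich[OF low up tendsto_const lim])
  then show ?thesis unfolding Let_def \<alpha>_def[symmetric]
    by (intro conjI allI impI special(1)) (elim conjE, rule decay(1))
qed

end
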